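(* Let $(M,\tau)$ be a tracial von Neumann algebra and let $\varphi$ be a normal regular strongly generating hyperstate on $\mathcal B(L^2(M,\tau))$. Then $$\mathrm{Har}(\mathcal B(L^2(M,\tau)),\mathcal P_\varphi)\cap \mathrm{Har}(\mathcal B(L^2(M,\tau)),\mathcal P_\varphi^{\rm o})=\mathcal Z(M).$$
   Context: A tracial von Neumann algebra $(M,\tau)$ is a finite von Neumann algebra with a faithful normal tracial state $\tau$; $M$ acts on $L^2(M,\tau)$ by left multiplication, $\hat x$ denotes $x\in M$ viewed as a vector in $L^2(M,\tau)$, $J\hat x=\widehat{x^*}$ is the canonical conjugation, $M'=JMJ$, and $\mathcal Z(M)$ is the center of $M$. A hyperstate on $\mathcal B(L^2(M,\tau))$ is a state $\varphi$ with $\varphi|_M=\tau$. Its associated map $\mathcal P_\varphi$ is the unique unital completely positive (u.c.p.) $M$-bimodular map on $\mathcal B(L^2(M,\tau))$ with $\langle \mathcal P_\varphi(T)\hat y,\hat z\rangle=\varphi(z^*Ty)$ for $y,z\in M$; it is normal iff $\varphi$ is normal. For a u.c.p. map $\mathcal P$ on a unital $C^*$-algebra $A$, $\mathrm{Har}(A,\mathcal P)=\{a\in A:\mathcal P(a)=a\}$. $\varphi$ is regular if the restriction of $\mathcal P_\varphi$ to $M'$ (which $\mathcal P_\varphi$ maps into itself) preserves the canonical trace $x'\mapsto\langle x'\hat 1,\hat 1\rangle$ on $M'$. If $\varphi$ is regular, $\varphi^*(T)=\varphi(JT^*J)$ is again a hyperstate. For $\varphi$ regular and normal, $\mathcal P_\varphi^{\rm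 o}=\mathrm{Ad}(J)\circ\mathcal P_{\varphi^*}\circ\mathrm{Ad}(J)$, where $\mathrm{Ad}(J)(T)=JTJ$. Every normal hyperstate has a standard form: there is a $\tau$-orthogonal family $\{z_n\}_n\subset M$ (i.e. $\tau(z_m^*z_n)=0$ for $m\ne n$) with $\sum_n z_n^*z_n=1$, $\varphi(T)=\sum_n\langle T\widehat{z_n^*},\widehat{z_n^*}\rangle$ and $\mathcal P_\varphi(T)=\sum_n (Jz_n^*J)T(Jz_nJ)$. $\varphi$ is strongly generating if the unital algebra (not $*$-algebra) generated by $\{z_n\}_n$ is weakly dense in $M$. *)

theory Defs
  imports "HOL-Analysis.Analysis"
begin

section \<open>Complex Hilbert spaces and their bounded operators\<close>

text \<open>The inner product is linear in the first variable. Positivity, definiteness and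
  \<open>norm x = sqrt (Re (cinner x x))\<close> are inherited from \<^class>\<open>real_inner\<close> through
  \<open>inner_eq_Re_cinner\<close>.\<close>

class chilbert_space = real_inner + complete_space +
  fixes scaleC :: "complex \<Rightarrow> 'a \<Rightarrow> 'a" (infixr "*\<^sub>C" 75)
    and cinner :: "'a \<Rightarrow> 'a \<Rightarrow> complex"
  assumes scaleC_add_right: "c *\<^sub>C (x + y) = c *\<^sub>C x + c *\<^sub>C y"
    and scaleC_add_left: "(c + d) *\<^sub>C x = c *\<^sub>C x + d *\<^sub>C x"
    and scaleC_scaleC: "c *\<^sub>C d *\<^sub>C x = (c * d) *\<^sub>C x"
    and scaleR_eq_scaleC: "r *\<^sub>R x = of_real r *\<^sub>C x"
    and cinner_add_left: "cinner (x + y) z = cinner x z + cinner y z"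
    and cinner_scaleC_left: "cinner (c *\<^sub>C x) y = c * cinner x y"
    and cinner_commute: "cinner x y = cnj (cinner y x)"
    and inner_eq_Re_cinner: "inner x y = Re (cinner x y)"

text \<open>Operators are taken in the library type \<^typ>\<open>'h \<Rightarrow>\<^sub>L 'h\<close> of bounded
  \<^emph>\<open>real\<close>-linear maps, which contains both the algebra of bounded complex-linear
  operators, carved out by \<open>bounded_ops\<close>, and the antilinear conjugation below.\<close>

type_synonym 'h oper = "'h \<Rightarrow>\<^sub>L 'h"

definition bounded_ops :: "'h::chilbert_space oper set" where
  "bounded_ops = {T :: 'h oper. \<forall>c x. T (c *\<^sub>C x) = c *\<^sub>C T x}"

definition scale_op :: "complex \<Rightarrow> 'h::chilbert_space oper \<Rightarrow> 'h oper" where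
  "scale_op c T = Blinfun (\<lambda>x. c *\<^sub>C T x)"

lemma cinner_scaleC_right: "cinner x (c *\<^sub>C y) = cnj c * cinner x y"
  for x y :: "'h::chilbert_space"
  by (metis cinner_commute cinner_scaleC_left complex_cnj_mult)

lemma norm_scaleC: "norm (c *\<^sub>C x) = cmod c * norm x" for x :: "'h::chilbert_space"
proof -
  have "inner (c *\<^sub>C x) (c *\<^sub>C x) = Re (c * cnj c * cinner x x)"
    by (simp add: inner_eq_Re_cinner cinner_scaleC_left cinner_scaleC_right algebra_simps)
  also have "\<dots> = (cmod c)\<^sup>2 * inner x x"
    by (simp only: complex_norm_square[symmetric] inner_eq_Re_cinner Re_complex_of_real
        times_complex.sel Im_complex_of_real mult_zero_left diff_zero)
  finally show ?thesis
    by (simp add: norm_eq_sqrt_inner real_sqrt_mult)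
qed

lemma scale_op_apply: "scale_op c T x = c *\<^sub>C T x" for T :: "'h::chilbert_space oper"
proof -
  have "bounded_linear (\<lambda>x. c *\<^sub>C T x)"
  proof (rule bounded_linear_intro[where K = "cmod c * norm T"])
    fix x y and r :: real
    show "c *\<^sub>C T (x + y) = c *\<^sub>C T x + c *\<^sub>C T y"
      by (simp add: blinfun.add_right scaleC_add_right)
    show "c *\<^sub>C T (r *\<^sub>R x) = r *\<^sub>R (c *\<^sub>C T x)"
      unfolding blinfun.scaleR_right by (simp add: scaleR_eq_scaleC scaleC_scaleC mult.commute)
    show "norm (c *\<^sub>C T x) \<le> norm x * (cmod c * norm T)"
      using mult_left_mono[OF norm_blinfun[of T x] norm_ge_zero[of c]]
      by (simp add: norm_scaleC mult_ac)
  qed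
  then show ?thesis
    by (simp add: scale_op_def bounded_linear_Blinfun_apply)
qed

definition adj :: "'h::chilbert_space oper \<Rightarrow> 'h oper" where
  "adj T = (THE S :: 'h oper. S \<in> bounded_ops \<and> (\<forall>x y. cinner (S x) y = cinner x (T y)))"

definition positive_op :: "'h::chilbert_space oper \<Rightarrow> bool" where
  "positive_op T \<longleftrightarrow> T \<in> bounded_ops \<and> (\<forall>x. cinner (T x) x \<in> \<real>\<^sub>\<ge>\<^sub>0)"

definition self_adjoint_in :: "'h::chilbert_space oper set \<Rightarrow> 'h oper set" where
  "self_adjoint_in A = {T \<in> A. adj T = T}"

definition weak_operator_topology :: "'h::chilbert_space oper topology" where
  "weak_operator_topology =
     pullback_topology UNIV (\<lambda>(T :: 'h oper) (p :: 'h \<times> 'h). cinner (T (fst p)) (snd p)) euclidean"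


section \<open>Tracial von Neumann algebras\<close>

definition unital_subalgebra :: "'h::chilbert_space oper set \<Rightarrow> bool" where
  "unital_subalgebra A \<longleftrightarrow>
     A \<subseteq> bounded_ops \<and> id_blinfun \<in> A \<and>
     (\<forall>S\<in>A. \<forall>T\<in>A. S + T \<in> A \<and> S o\<^sub>L T \<in> A) \<and>
     (\<forall>c. \<forall>T\<in>A. scale_op c T \<in> A)"

definition commutant :: "'h::chilbert_space oper set \<Rightarrow> 'h oper set" where
  "commutant A = {T \<in> bounded_ops. \<forall>x\<in>A. T o\<^sub>L x = x o\<^sub>L T}"

definition von_neumann_algebra :: "'h::chilbert_space oper set \<Rightarrow> bool" where
  "von_neumann_algebra M \<longleftrightarrow>
     unital_subalgebra M \<and> (\<forall>x\<in>M. adj x \<in> M) \<and> commutant (commutant M) = M"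

definition center :: "'h::chilbert_space oper set \<Rightarrow> 'h oper set" where
  "center M = M \<inter> commutant M"

definition linear_on_alg ::
  "'h::chilbert_space oper set \<Rightarrow> ('h oper \<Rightarrow> complex) \<Rightarrow> bool" where
  "linear_on_alg A f \<longleftrightarrow>
     (\<forall>S\<in>A. \<forall>T\<in>A. f (S + T) = f S + f T) \<and> (\<forall>c. \<forall>T\<in>A. f (scale_op c T) = c * f T)"

definition state_on ::
  "'h::chilbert_space oper set \<Rightarrow> ('h oper \<Rightarrow> complex) \<Rightarrow> bool" where
  "state_on A f \<longleftrightarrow>
     linear_on_alg A f \<and> (\<forall>T\<in>A. positive_op T \<longrightarrow> f T \<in> \<real>\<^sub>\<ge>\<^sub>0) \<and> f id_blinfun = 1"

text \<open>Normality: suprema of upward directed families of self-adjoint elements are preserved.\<close>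

definition normal_on ::
  "'h::chilbert_space oper set \<Rightarrow> ('h oper \<Rightarrow> complex) \<Rightarrow> bool" where
  "normal_on A f \<longleftrightarrow>
     (\<forall>D s. D \<subseteq> self_adjoint_in A \<and> D \<noteq> {} \<and>
        (\<forall>a\<in>D. \<forall>b\<in>D. \<exists>d\<in>D. positive_op (d - a) \<and> positive_op (d - b)) \<and>
        s \<in> self_adjoint_in A \<and> (\<forall>d\<in>D. positive_op (s - d)) \<and>
        (\<forall>u\<in>self_adjoint_in A. (\<forall>d\<in>D. positive_op (u - d)) \<longrightarrow> positive_op (u - s))
        \<longrightarrow> Re (f s) = (SUP d\<in>D. Re (f d)))"

definition tracial_von_neumann_algebra ::
  "'h::chilbert_space oper set \<Rightarrow> ('h oper \<Rightarrow> complex) \<Rightarrow> bool" where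
  "tracial_von_neumann_algebra M \<tau> \<longleftrightarrow>
     von_neumann_algebra M \<and>
     (\<forall>u\<in>M. adj u o\<^sub>L u = id_blinfun \<longrightarrow> u o\<^sub>L adj u = id_blinfun) \<and>
     state_on M \<tau> \<and> normal_on M \<tau> \<and>
     (\<forall>x\<in>M. \<forall>y\<in>M. \<tau> (x o\<^sub>L y) = \<tau> (y o\<^sub>L x)) \<and>
     (\<forall>x\<in>M. \<tau> (adj x o\<^sub>L x) = 0 \<longrightarrow> x = 0)"

text \<open>The Hilbert space \<open>'h\<close> on which \<open>M\<close> acts is \<open>L\<^sup>2(M,\<tau>)\<close>: it is the completion of \<open>M\<close>,
  embedded by \<open>hat\<close>, for the inner product \<open>\<langle>x,y\<rangle> = \<tau>(y\<^sup>*x)\<close>, and \<open>M\<close> acts by left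
  multiplication.\<close>

definition L2_representation ::
  "'h::chilbert_space oper set \<Rightarrow> ('h oper \<Rightarrow> complex) \<Rightarrow> ('h oper \<Rightarrow> 'h) \<Rightarrow> bool" where
  "L2_representation M \<tau> hat \<longleftrightarrow>
     (\<forall>x\<in>M. \<forall>y\<in>M. hat (x + y) = hat x + hat y) \<and>
     (\<forall>c. \<forall>x\<in>M. hat (scale_op c x) = c *\<^sub>C hat x) \<and>
     (\<forall>x\<in>M. \<forall>y\<in>M. cinner (hat x) (hat y) = \<tau> (adj y o\<^sub>L x)) \<and>
     closure (hat ` M) = UNIV \<and>
     (\<forall>x\<in>M. \<forall>y\<in>M. blinfun_apply x (hat y) = hat (x o\<^sub>L y))"

definition conjugation ::
  "'h::chilbert_space oper set \<Rightarrow> ('h oper \<Rightarrow> 'h) \<Rightarrow> 'h oper" where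
  "conjugation M hat = (THE J :: 'h oper. \<forall>x\<in>M. J (hat x) = hat (adj x))"

definition AdJ ::
  "'h::chilbert_space oper set \<Rightarrow> ('h oper \<Rightarrow> 'h) \<Rightarrow> 'h oper \<Rightarrow> 'h oper" where
  "AdJ M hat T = conjugation M hat o\<^sub>L T o\<^sub>L conjugation M hat"


section \<open>Completely positive maps and hyperstates\<close>

text \<open>An \<open>n \<times> n\<close> matrix over \<open>bounded_ops\<close> is positive as an operator on the \<open>n\<close>-fold direct
  sum of the Hilbert space.\<close>

definition positive_matrix :: "nat \<Rightarrow> (nat \<Rightarrow> nat \<Rightarrow> 'h::chilbert_space oper) \<Rightarrow> bool" where
  "positive_matrix n T \<longleftrightarrow>
     (\<forall>i<n. \<forall>j<n. T i j \<in> bounded_ops) \<and>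
     (\<forall>\<xi> :: nat \<Rightarrow> 'h. (\<Sum>i<n. \<Sum>j<n. cinner (T i j (\<xi> j)) (\<xi> i)) \<in> \<real>\<^sub>\<ge>\<^sub>0)"

definition ucp :: "('h::chilbert_space oper \<Rightarrow> 'h oper) \<Rightarrow> bool" where
  "ucp P \<longleftrightarrow>
     P \<in> bounded_ops \<rightarrow> bounded_ops \<and>
     (\<forall>S\<in>bounded_ops. \<forall>T\<in>bounded_ops. P (S + T) = P S + P T) \<and>
     (\<forall>c. \<forall>T\<in>bounded_ops. P (scale_op c T) = scale_op c (P T)) \<and>
     P id_blinfun = id_blinfun \<and>
     (\<forall>n T. positive_matrix n T \<longrightarrow> positive_matrix n (\<lambda>i j. P (T i j)))"

definition bimodular ::
  "'h::chilbert_space oper set \<Rightarrow> ('h oper \<Rightarrow> 'h oper) \<Rightarrow> bool" where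
  "bimodular M P \<longleftrightarrow>
     (\<forall>x\<in>M. \<forall>y\<in>M. \<forall>T\<in>bounded_ops. P (x o\<^sub>L T o\<^sub>L y) = x o\<^sub>L P T o\<^sub>L y)"

definition Har ::
  "'h::chilbert_space oper set \<Rightarrow> ('h oper \<Rightarrow> 'h oper) \<Rightarrow> 'h oper set" where
  "Har A P = {a \<in> A. P a = a}"

definition hyperstate ::
  "'h::chilbert_space oper set \<Rightarrow> ('h oper \<Rightarrow> complex) \<Rightarrow> ('h oper \<Rightarrow> complex) \<Rightarrow> bool" where
  "hyperstate M \<tau> \<phi> \<longleftrightarrow> state_on bounded_ops \<phi> \<and> (\<forall>x\<in>M. \<phi> x = \<tau> x)"

text \<open>\<^const>\<open>extensional\<close> fixes the irrelevant values outside \<open>bounded_ops\<close>, so that the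
  description is unique.\<close>

definition hyper_map ::
  "'h::chilbert_space oper set \<Rightarrow> ('h oper \<Rightarrow> 'h) \<Rightarrow> ('h oper \<Rightarrow> complex) \<Rightarrow> 'h oper \<Rightarrow> 'h oper"
  where
  "hyper_map M hat \<phi> =
     (THE P. P \<in> extensional bounded_ops \<and> ucp P \<and> bimodular M P \<and>
        (\<forall>T\<in>bounded_ops. \<forall>y\<in>M. \<forall>z\<in>M.
           cinner (P T (hat y)) (hat z) = \<phi> (adj z o\<^sub>L T o\<^sub>L y)))"

definition regular ::
  "'h::chilbert_space oper set \<Rightarrow> ('h oper \<Rightarrow> 'h) \<Rightarrow> ('h oper \<Rightarrow> complex) \<Rightarrow> bool" where
  "regular M hat \<phi> \<longleftrightarrow>
     (\<forall>x\<in>commutant M. cinner (hyper_map M hat \<phi> x (hat id_blinfun)) (hat id_blinfun)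
        = cinner (blinfun_apply x (hat id_blinfun)) (hat id_blinfun))"

definition star_hyperstate ::
  "'h::chilbert_space oper set \<Rightarrow> ('h oper \<Rightarrow> 'h) \<Rightarrow> ('h oper \<Rightarrow> complex) \<Rightarrow> 'h oper \<Rightarrow> complex"
  where
  "star_hyperstate M hat \<phi> T = \<phi> (AdJ M hat (adj T))"

definition opp_hyper_map ::
  "'h::chilbert_space oper set \<Rightarrow> ('h oper \<Rightarrow> 'h) \<Rightarrow> ('h oper \<Rightarrow> complex) \<Rightarrow> 'h oper \<Rightarrow> 'h oper"
  where
  "opp_hyper_map M hat \<phi> =
     AdJ M hat \<circ> hyper_map M hat (star_hyperstate M hat \<phi>) \<circ> AdJ M hat"

text \<open>Sums of operators converge strongly. The family is indexed by \<^typ>\<open>nat\<close>; a finite family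
  is padded by zeros, which does not change the generated unital algebra.\<close>

definition standard_form ::
  "'h::chilbert_space oper set \<Rightarrow> ('h oper \<Rightarrow> complex) \<Rightarrow> ('h oper \<Rightarrow> 'h) \<Rightarrow>
   ('h oper \<Rightarrow> complex) \<Rightarrow> (nat \<Rightarrow> 'h oper) \<Rightarrow> bool" where
  "standard_form M \<tau> hat \<phi> z \<longleftrightarrow>
     (\<forall>n. z n \<in> M) \<and>
     (\<forall>m n. m \<noteq> n \<longrightarrow> \<tau> (adj (z m) o\<^sub>L z n) = 0) \<and>
     (\<forall>\<xi>. (\<lambda>n. (adj (z n) o\<^sub>L z n) \<xi>) sums \<xi>) \<and>
     (\<forall>T\<in>bounded_ops. (\<lambda>n. cinner (blinfun_apply T (hat (adj (z n)))) (hat (adj (z n)))) sums \<phi> T) \<and>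
     (\<forall>T\<in>bounded_ops. \<forall>\<xi>.
        (\<lambda>n. (AdJ M hat (adj (z n)) o\<^sub>L T o\<^sub>L AdJ M hat (z n)) \<xi>) sums (hyper_map M hat \<phi> T \<xi>))"

definition strongly_generating ::
  "'h::chilbert_space oper set \<Rightarrow> ('h oper \<Rightarrow> complex) \<Rightarrow> ('h oper \<Rightarrow> 'h) \<Rightarrow>
   ('h oper \<Rightarrow> complex) \<Rightarrow> bool" where
  "strongly_generating M \<tau> hat \<phi> \<longleftrightarrow>
     (\<exists>z. standard_form M \<tau> hat \<phi> z \<and>
        M \<subseteq> weak_operator_topology closure_of (unital_subalgebra hull range z))"

end

theory Submission
  imports Defs
begin

text \<open>Let \<open>\<Omega>\<close> be the vector of the unit of \<open>M\<close>. In standard form the map of \<open>\<phi>\<close> is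
  \<open>P T = (\<Sum>n. (J z\<^sub>n\<^sup>* J) T (J z\<^sub>n J))\<close> and the opposite map is \<open>Q T = (\<Sum>n. z\<^sub>n T z\<^sub>n\<^sup>*)\<close>
  (\<open>opp_hyper_map_sums\<close>); regularity says that \<open>Q\<close> is unital (\<open>column_left\<close>). The two maps commute, as
  \<open>M\<close> commutes with \<open>J M J\<close>, and the vector states of \<open>P T\<close> and \<open>Q T\<close> at \<open>\<Omega>\<close> agree because
  \<open>J z\<^sub>n J \<Omega> = z\<^sub>n\<^sup>* \<Omega>\<close>. Central elements are clearly fixed by both maps.

  Conversely, let \<open>T\<close> be fixed by both. The Schwarz inequality has the exact form
  \<open>Q(T\<^sup>* T) - T\<^sup>* T = (\<Sum>n. S\<^sub>n\<^sup>* S\<^sub>n)\<close> with \<open>S\<^sub>n = [T, z\<^sub>n\<^sup>*]\<close> (\<open>harmonic_defect\<close>). Applying \<open>P\<^sup>k\<close> and the vector state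
  \<open>\<omega>\<close> at \<open>\<Omega>\<close> gives \<open>\<omega>(P\<^sup>k\<^sup>+\<^sup>1(T\<^sup>* T)) - \<omega>(P\<^sup>k(T\<^sup>* T)) = (\<Sum>n. \<omega>(P\<^sup>k(S\<^sub>n\<^sup>* S\<^sub>n)))\<close>. The sequence \<open>\<omega>(P\<^sup>k(T\<^sup>* T))\<close> is
  bounded and every \<open>\<omega>(P\<^sup>k(S\<^sub>n\<^sup>* S\<^sub>n))\<close> increases with \<open>k\<close>, as \<open>S\<^sub>n\<close> is \<open>P\<close>-harmonic; so all the latter vanish
  (\<open>doubly_harmonic_commutator_kills_words\<close>). This means that \<open>S\<^sub>n\<close> annihilates the orbit of \<open>\<Omega>\<close> under
  the algebra generated by the \<open>J z\<^sub>m J\<close>, which is dense by strong generation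
  (\<open>right_action_word_separates\<close>). Hence \<open>S\<^sub>n = 0\<close>, and the same for \<open>T\<^sup>*\<close> shows that \<open>T\<close> lies in \<open>M'\<close>.

  Once \<open>T\<close> is in \<open>M'\<close>, it also commutes with the \<open>J z\<^sub>n J\<close>, now by the defect identity for \<open>P\<close> at \<open>\<Omega>\<close>
  (\<open>doubly_harmonic_central\<close>). So \<open>T\<close> commutes with \<open>J M J\<close>, and by the commutation theorem
  (\<open>right_commutant_subset\<close>) it belongs to \<open>M\<close>. The adjoint, the conjugation \<open>J\<close> and the map of \<open>\<phi>\<^sup>*\<close> are given
  by definite descriptions; \<open>adj_exists\<close>, \<open>conjugation_exists\<close> and \<open>hyper_map_star\<close> show that they exist.\<close>

section \<open>Commuting column isometries and their harmonic operators\<close>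

lemma ennreal_suminf_swap:
  fixes f :: "nat \<Rightarrow> nat \<Rightarrow> ennreal"
  shows "(\<Sum>i. \<Sum>j. f i j) = (\<Sum>j. \<Sum>i. f i j)"
proof -
  have "(\<Sum>i. \<integral>\<^sup>+j. f i j \<partial>count_space UNIV) = (\<integral>\<^sup>+j. (\<Sum>i. f i j) \<partial>count_space UNIV)"
    by (rule nn_integral_suminf[symmetric]) simp
  then show ?thesis
    by (simp add: nn_integral_count_space_nat)
qed

text \<open>The two maps of the theorem have the form \<open>T \<mapsto> \<Sum>n. (a n)\<^sup>* T (a n)\<close>. Isometry of the column of all
  \<open>a n\<close> makes such a map unital, and \<open>harmonic\<close> is the fixed point equation \<open>(\<Sum>n. (a n)\<^sup>* T (a n)) = T\<close>
  in weak form, so that no adjoint has to be mentioned.\<close>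

definition column_isometry :: "(nat \<Rightarrow> 'a::real_inner \<Rightarrow>\<^sub>L 'a) \<Rightarrow> bool" where
  "column_isometry a \<longleftrightarrow> (\<forall>\<xi>. (\<lambda>n. (norm (a n \<xi>))\<^sup>2) sums (norm \<xi>)\<^sup>2)"

definition harmonic :: "(nat \<Rightarrow> 'a::real_inner \<Rightarrow>\<^sub>L 'a) \<Rightarrow> ('a \<Rightarrow>\<^sub>L 'a) \<Rightarrow> bool" where
  "harmonic a T \<longleftrightarrow> (\<forall>\<xi> \<eta>. (\<lambda>n. inner (T (a n \<xi>)) (a n \<eta>)) sums inner (T \<xi>) \<eta>)"

text \<open>If \<open>q \<xi> = \<langle>X \<xi>, \<xi>\<rangle>\<close> for a positive operator \<open>X\<close>, then \<open>push a q\<close> is the quadratic form of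
  \<open>\<Sum>n. (a n)\<^sup>* X (a n)\<close>. Acting on \<open>[0,\<infinity>]\<close>-valued functions instead of operators makes every series
  converge and every interchange of summations legitimate.\<close>

definition push :: "(nat \<Rightarrow> 'a::real_inner \<Rightarrow>\<^sub>L 'a) \<Rightarrow> ('a \<Rightarrow> ennreal) \<Rightarrow> 'a \<Rightarrow> ennreal" where
  "push a q \<xi> = (\<Sum>n. q (a n \<xi>))"

lemma column_isometry_push:
  assumes "column_isometry a"
  shows "push a (\<lambda>\<xi>. ennreal (K * (norm \<xi>)\<^sup>2)) \<xi> = ennreal (K * (norm \<xi>)\<^sup>2)"
proof (cases "K \<ge> 0")
  case True
  have "(\<lambda>n. K * (norm (a n \<xi>))\<^sup>2) sums (K * (norm \<xi>)\<^sup>2)"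
    using assms by (intro sums_mult) (simp add: column_isometry_def)
  then show ?thesis
    using True unfolding push_def by (intro suminf_ennreal_eq) auto
next
  case False
  then have "K * x\<^sup>2 \<le> 0" for x :: real
    by (simp add: mult_le_0_iff)
  then show ?thesis
    by (simp add: push_def ennreal_neg)
qed

lemma push_mono:
  assumes "\<And>\<xi>. q \<xi> \<le> r \<xi>"
  shows "push a q \<xi> \<le> push a r \<xi>"
  unfolding push_def by (intro suminf_le assms) auto

lemma push_add: "push a (\<lambda>\<xi>. q \<xi> + r \<xi>) \<xi> = push a q \<xi> + push a r \<xi>"
  unfolding push_def by (rule suminf_add[symmetric]) auto

lemma push_commute:
  fixes a c :: "nat \<Rightarrow> 'a::real_inner \<Rightarrow>\<^sub>L 'a"
  assumes "\<And>m n \<xi>. c n (a m \<xi>) = a m (c n \<xi>)"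
  shows "push a (push c q) = push c (push a q)"
  unfolding push_def using assms by (auto intro!: ext ennreal_suminf_swap[THEN trans])

lemma push_pow_mono:
  assumes "\<And>\<xi>. q \<xi> \<le> r \<xi>"
  shows "(push a ^^ k) q \<xi> \<le> (push a ^^ k) r \<xi>"
  using assms by (induction k arbitrary: \<xi>) (auto intro: push_mono)

lemma push_pow_add:
  "(push a ^^ k) (\<lambda>\<xi>. q \<xi> + r \<xi>) \<xi> = (push a ^^ k) q \<xi> + (push a ^^ k) r \<xi>"
proof (induction k arbitrary: \<xi>)
  case (Suc k)
  have "(push a ^^ k) (\<lambda>\<xi>. q \<xi> + r \<xi>) = (\<lambda>\<xi>. (push a ^^ k) q \<xi> + (push a ^^ k) r \<xi>)"
    using Suc by auto
  then show ?case by (simp add: push_add)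
qed simp

lemma push_pow_commute:
  fixes a c :: "nat \<Rightarrow> 'a::real_inner \<Rightarrow>\<^sub>L 'a"
  assumes "\<And>m n \<xi>. c n (a m \<xi>) = a m (c n \<xi>)"
  shows "(push a ^^ k) (push c q) = push c ((push a ^^ k) q)"
  by (induction k) (simp_all add: push_commute[OF assms])

text \<open>The \<open>k\<close>-th power of \<open>push a\<close> sums \<open>q\<close> over all words of length \<open>k\<close> in the operators \<open>a n\<close>; each
  word contributes one summand.\<close>

lemma word_le_push_pow: "q (fold (\<lambda>m. blinfun_apply (a m)) ms \<xi>) \<le> (push a ^^ length ms) q \<xi>"
proof (induction ms arbitrary: \<xi>)
  case (Cons m ms)
  have "q (fold (\<lambda>m. blinfun_apply (a m)) (m # ms) \<xi>) \<le> (push a ^^ length ms) q (a m \<xi>)"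
    using Cons by simp
  also have "\<dots> \<le> push a ((push a ^^ length ms) q) \<xi>"
    using sum_le_suminf[of "\<lambda>n. (push a ^^ length ms) q (a n \<xi>)" "{m}"]
    by (simp add: push_def[of a "(push a ^^ length ms) q"])
  finally show ?case by simp
qed simp

text \<open>For a fixed point \<open>T\<close> of \<open>\<Phi>(X) = (\<Sum>n. (a n)\<^sup>* X (a n))\<close> this is the identity
  \<open>\<Phi>(T\<^sup>* T) - T\<^sup>* T = (\<Sum>n. [T, a n]\<^sup>* [T, a n])\<close>: expanding the square, the two cross terms are
  \<open>\<Phi>(T)\<^sup>* T\<close> and its adjoint, and unitality handles the last term. It refines the Schwarz
  inequality for \<open>\<Phi>\<close>.\<close>

lemma harmonic_defect:
  assumes a: "column_isometry a" and T: "harmonic a T"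
  shows "ennreal ((norm (T \<xi>))\<^sup>2) + (\<Sum>n. ennreal ((norm (T (a n \<xi>) - a n (T \<xi>)))\<^sup>2))
           = push a (\<lambda>\<xi>. ennreal ((norm (T \<xi>))\<^sup>2)) \<xi>"
proof -
  have sm: "summable (\<lambda>n. (norm (T (a n \<xi>)))\<^sup>2)"
  proof (rule summable_comparison_test)
    show "summable (\<lambda>n. (norm T)\<^sup>2 * (norm (a n \<xi>))\<^sup>2)"
      using a by (intro summable_mult) (auto simp: column_isometry_def sums_iff)
    show "\<exists>N. \<forall>n\<ge>N. norm ((norm (T (a n \<xi>)))\<^sup>2) \<le> (norm T)\<^sup>2 * (norm (a n \<xi>))\<^sup>2"
      by (auto simp flip: power_mult_distrib intro!: power_mono norm_blinfun)
  qed
  have "(\<lambda>n. (norm (T (a n \<xi>)))\<^sup>2 - 2 * inner (T (a n \<xi>)) (a n (T \<xi>)) + (norm (a n (T \<xi>)))\<^sup>2)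
      sums ((\<Sum>n. (norm (T (a n \<xi>)))\<^sup>2) - 2 * inner (T \<xi>) (T \<xi>) + (norm (T \<xi>))\<^sup>2)"
    using a T by (intro sums_add sums_diff sums_mult summable_sums[OF sm])
      (auto simp: column_isometry_def harmonic_def)
  then have sq: "(\<lambda>n. (norm (T (a n \<xi>) - a n (T \<xi>)))\<^sup>2)
      sums ((\<Sum>n. (norm (T (a n \<xi>)))\<^sup>2) - (norm (T \<xi>))\<^sup>2)"
    by (simp add: power2_norm_eq_inner inner_diff_left inner_diff_right inner_commute algebra_simps)
  then have *: "(\<Sum>n. ennreal ((norm (T (a n \<xi>) - a n (T \<xi>)))\<^sup>2))
      = ennreal ((\<Sum>n. (norm (T (a n \<xi>)))\<^sup>2) - (norm (T \<xi>))\<^sup>2)"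
    by (auto intro: suminf_ennreal_eq)
  have ge: "0 \<le> (\<Sum>n. (norm (T (a n \<xi>)))\<^sup>2) - (norm (T \<xi>))\<^sup>2"
    by (rule sums_le[OF _ sums_zero sq]) simp
  have "push a (\<lambda>\<xi>. ennreal ((norm (T \<xi>))\<^sup>2)) \<xi> = ennreal (\<Sum>n. (norm (T (a n \<xi>)))\<^sup>2)"
    unfolding push_def by (intro suminf_ennreal2 sm) auto
  then show ?thesis
    using ge by (simp add: * flip: ennreal_plus)
qed

lemma ennreal_increment_zero_if_bounded:
  fixes f :: "nat \<Rightarrow> ennreal"
  assumes "\<And>k. f k + c \<le> f (Suc k)" and "\<And>k. f k \<le> B" and "B < \<infinity>"
  shows "c = 0"
proof (rule ccontr)
  assume "c \<noteq> 0"
  have ge: "of_nat k * c \<le> f k" for k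
  proof (induction k)
    case (Suc k)
    have "of_nat (Suc k) * c = of_nat k * c + c" by (simp add: algebra_simps)
    also have "\<dots> \<le> f k + c" using Suc by (intro add_right_mono)
    also have "\<dots> \<le> f (Suc k)" by (rule assms)
    finally show ?case .
  qed simp
  have "c \<le> B" using ge[of 1] assms(2)[of 1] by simp
  then have "c < \<infinity>" using assms(3) by (rule le_less_trans)
  then obtain r where r: "c = ennreal r" "r > 0" "r \<ge> 0"
    using \<open>c \<noteq> 0\<close> by (cases c) auto
  obtain b where b: "B = ennreal b" "b \<ge> 0"
    using assms(3) by (cases B) auto
  obtain k where "b < of_nat k * r" using reals_Archimedean3[OF r(2)] by blast
  moreover have "ennreal (of_nat k * r) \<le> ennreal b"
    using order_trans[OF ge assms(2), of k] r b by (simp add: ennreal_mult ennreal_of_nat_eq_real_of_nat)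
  ultimately show False using r b by simp
qed

text \<open>The core of the argument. Write \<open>P\<close> and \<open>Q\<close> for \<open>push a\<close> and \<open>push c\<close>, \<open>q\<close> for the quadratic form
  of \<open>T\<^sup>* T\<close> and \<open>s\<close> for that of \<open>S\<^sup>* S\<close>, where \<open>S = [T, c n]\<close>. The defect identity for \<open>c\<close> gives
  \<open>q + s \<le> Q q\<close>. As \<open>P\<close> and \<open>Q\<close> commute, and agree at the vector \<open>\<Omega>\<close>, applying \<open>P\<close> to the power \<open>k\<close>
  yields \<open>P\<^sup>k q + P\<^sup>k s \<le> P\<^sup>k\<^sup>+\<^sup>1 q\<close> at \<open>\<Omega>\<close>. Now \<open>P\<^sup>k q\<close> stays below \<open>\<parallel>T\<parallel>\<^sup>2 \<parallel>\<Omega>\<parallel>\<^sup>2\<close>, while \<open>P\<^sup>k s\<close> increases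
  with \<open>k\<close>, because \<open>S\<close> is again harmonic for \<open>a\<close>. Increments that do not decrease are compatible
  with a bounded sequence only if they vanish, so \<open>P\<^sup>k s\<close> is \<open>0\<close> at \<open>\<Omega>\<close> for every \<open>k\<close>, which says
  that \<open>S\<close> annihilates every word in the \<open>a m\<close> applied to \<open>\<Omega>\<close>.\<close>

theorem doubly_harmonic_commutator_kills_words:
  fixes a c d :: "nat \<Rightarrow> 'a::real_inner \<Rightarrow>\<^sub>L 'a"
  assumes a: "column_isometry a" and c: "column_isometry c"
    and adj: "\<And>n \<xi> \<eta>. inner (c n \<xi>) \<eta> = inner \<xi> (d n \<eta>)"
    and ca: "\<And>m n \<xi>. c n (a m \<xi>) = a m (c n \<xi>)" and da: "\<And>m n \<xi>. d n (a m \<xi>) = a m (d n \<xi>)"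
    and \<Omega>: "\<And>n. a n \<Omega> = c n \<Omega>"
    and Ta: "harmonic a T" and Tc: "harmonic c T"
  shows "((T o\<^sub>L c n) - (c n o\<^sub>L T)) (fold (\<lambda>m. blinfun_apply (a m)) ms \<Omega>) = 0"
proof -
  define S where "S = (T o\<^sub>L c n) - (c n o\<^sub>L T)"
  define q where "q = (\<lambda>\<xi>. ennreal ((norm (T \<xi>))\<^sup>2))"
  define s where "s = (\<lambda>\<xi>. ennreal ((norm (S \<xi>))\<^sup>2))"
  have S: "S \<xi> = T (c n \<xi>) - c n (T \<xi>)" for \<xi>
    by (simp add: S_def blinfun.diff_left)
  \<comment> \<open>Harmonicity of \<open>S\<close>: here \<open>c n\<close> and its adjoint \<open>d n\<close> must commute with every \<open>a m\<close>.\<close>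
  have "(\<lambda>m. inner (S (a m \<xi>)) (a m \<eta>)) sums inner (S \<xi>) \<eta>" for \<xi> \<eta>
  proof -
    have "(\<lambda>m. inner (T (a m (c n \<xi>))) (a m \<eta>) - inner (T (a m \<xi>)) (a m (d n \<eta>)))
        sums (inner (T (c n \<xi>)) \<eta> - inner (T \<xi>) (d n \<eta>))"
      using Ta by (intro sums_diff) (auto simp: harmonic_def)
    then show ?thesis
      by (simp add: S inner_diff_left adj ca da)
  qed
  then have S_harm: "harmonic a S" by (simp add: harmonic_def)
  have s_le: "s \<xi> \<le> push a s \<xi>" for \<xi>
    unfolding s_def harmonic_defect[OF a S_harm, symmetric, of \<xi>] by simp
  have qs_le: "q \<xi> + s \<xi> \<le> push c q \<xi>" for \<xi>
  proof -
    have "s \<xi> \<le> (\<Sum>m. ennreal ((norm (T (c m \<xi>) - c m (T \<xi>)))\<^sup>2))"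
      using sum_le_suminf[of "\<lambda>m. ennreal ((norm (T (c m \<xi>) - c m (T \<xi>)))\<^sup>2)" "{n}"]
      by (simp add: s_def S del: suminf_ennreal)
    then show ?thesis
      unfolding q_def harmonic_defect[OF c Tc, symmetric, of \<xi>] by (rule add_left_mono)
  qed
  have step: "(push a ^^ k) q \<Omega> + (push a ^^ k) s \<Omega> \<le> (push a ^^ Suc k) q \<Omega>" for k
  proof -
    have "(push a ^^ k) q \<Omega> + (push a ^^ k) s \<Omega> \<le> (push a ^^ k) (push c q) \<Omega>"
      using push_pow_mono[of "\<lambda>\<xi>. q \<xi> + s \<xi>" "push c q" k a \<Omega>] qs_le by (simp add: push_pow_add)
    also have "\<dots> = push c ((push a ^^ k) q) \<Omega>"
      by (simp add: push_pow_commute[OF ca])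
    also have "\<dots> = (push a ^^ Suc k) q \<Omega>"
      by (simp add: push_def[of _ "(push a ^^ k) q"] \<Omega>)
    finally show ?thesis .
  qed
  have bound: "(push a ^^ k) q \<xi> \<le> ennreal ((norm T)\<^sup>2 * (norm \<xi>)\<^sup>2)" for k \<xi>
  proof (induction k arbitrary: \<xi>)
    case 0
    then show ?case
      by (auto simp: q_def simp flip: power_mult_distrib intro!: ennreal_leI power_mono norm_blinfun)
  next
    case (Suc k)
    have "(push a ^^ Suc k) q \<xi> \<le> push a (\<lambda>\<xi>. ennreal ((norm T)\<^sup>2 * (norm \<xi>)\<^sup>2)) \<xi>"
      using Suc by (auto intro: push_mono)
    then show ?case by (simp only: column_isometry_push[OF a])
  qed
  have s_mono: "(push a ^^ j) s \<Omega> \<le> (push a ^^ (j + k)) s \<Omega>" for j k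
  proof (induction k)
    case (Suc k)
    have "(push a ^^ (j + k)) s \<Omega> \<le> (push a ^^ (j + k)) (push a s) \<Omega>"
      by (intro push_pow_mono s_le)
    also have "\<dots> = (push a ^^ (j + Suc k)) s \<Omega>"
      by (simp only: add_Suc_right funpow_Suc_right o_apply)
    finally show ?case using Suc by (rule order_trans[rotated])
  qed simp
  have "(push a ^^ j) s \<Omega> = 0" for j
  proof (rule ennreal_increment_zero_if_bounded)
    fix k
    show "(push a ^^ (j + k)) q \<Omega> + (push a ^^ j) s \<Omega> \<le> (push a ^^ (j + Suc k)) q \<Omega>"
      using order_trans[OF add_left_mono[OF s_mono[of j k]] step[of "j + k"]] by simp
    show "(push a ^^ (j + k)) q \<Omega> \<le> ennreal ((norm T)\<^sup>2 * (norm \<Omega>)\<^sup>2)"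
      by (rule bound)
  qed simp
  then have "s (fold (\<lambda>m. blinfun_apply (a m)) ms \<Omega>) \<le> 0"
    using word_le_push_pow[of s a ms \<Omega>] by simp
  then show ?thesis
    by (simp add: s_def S_def)
qed

section \<open>Complex inner products\<close>

lemma Im_cinner: "Im (cinner x y) = inner x (\<i> *\<^sub>C y)" for x y :: "'h::chilbert_space"
  by (simp add: inner_eq_Re_cinner cinner_scaleC_right)

lemma cinner_eq_inner: "cinner x y = Complex (inner x y) (inner x (\<i> *\<^sub>C y))"
  for x y :: "'h::chilbert_space"
  by (simp add: complex_eq_iff Im_cinner inner_eq_Re_cinner)

lemma scaleC_diff_right: "c *\<^sub>C (x - y) = c *\<^sub>C x - c *\<^sub>C y" for x y :: "'h::chilbert_space"
  by (metis add_diff_cancel diff_add_cancel scaleC_add_right)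

lemma cinner_add_right: "cinner x (y + z) = cinner x y + cinner x z" for x y z :: "'h::chilbert_space"
  by (metis cinner_add_left cinner_commute complex_cnj_add)

lemma cinner_diff_left: "cinner (x - y) z = cinner x z - cinner y z" for x y z :: "'h::chilbert_space"
  by (metis add_diff_cancel cinner_add_left diff_add_cancel)

lemma cinner_diff_right: "cinner x (y - z) = cinner x y - cinner x z" for x y z :: "'h::chilbert_space"
  by (metis cinner_diff_left cinner_commute complex_cnj_diff)

lemma cinner_zero [simp]: "cinner 0 x = 0" "cinner x 0 = 0" for x :: "'h::chilbert_space"
  using cinner_diff_left[of x x x] cinner_diff_right[of x x x] by simp_all

lemma cinner_self: "cinner x x = complex_of_real ((norm x)\<^sup>2)" for x :: "'h::chilbert_space"
proof -
  have "Im (cinner x x) = 0"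
    by (metis Reals_cnj_iff cinner_commute complex_is_Real_iff)
  then show ?thesis
    by (simp add: complex_eq_iff power2_norm_eq_inner inner_eq_Re_cinner)
qed

lemma cinner_ext: "(\<And>z. cinner x z = cinner y z) \<Longrightarrow> x = y" for x y :: "'h::chilbert_space"
  by (metis cinner_diff_left cinner_self eq_iff_diff_eq_0 norm_eq_zero of_real_eq_0_iff power_eq_0_iff)

lemma bounded_linear_scaleC: "bounded_linear (\<lambda>x. c *\<^sub>C x :: 'h::chilbert_space)"
proof (rule bounded_linear_intro[where K = "cmod c"])
  fix x y :: 'h and r :: real
  show "c *\<^sub>C (x + y) = c *\<^sub>C x + c *\<^sub>C y" by (rule scaleC_add_right)
  show "c *\<^sub>C (r *\<^sub>R x) = r *\<^sub>R (c *\<^sub>C x)"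
    by (simp add: scaleR_eq_scaleC scaleC_scaleC mult.commute)
  show "norm (c *\<^sub>C x) \<le> norm x * cmod c" by (simp add: norm_scaleC)
qed

lemma continuous_on_scaleC [continuous_intros]:
  "continuous_on A f \<Longrightarrow> continuous_on A (\<lambda>x. c *\<^sub>C (f x :: 'h::chilbert_space))"
  by (rule bounded_linear.continuous_on[OF bounded_linear_scaleC])

lemma continuous_on_cinner [continuous_intros]:
  "continuous_on A f \<Longrightarrow> continuous_on A g \<Longrightarrow> continuous_on A (\<lambda>x. cinner (f x) (g x :: 'h::chilbert_space))"
  unfolding cinner_eq_inner Complex_eq by (intro continuous_intros)

lemma bounded_linear_cinner_left: "bounded_linear (\<lambda>x. cinner x (y :: 'h::chilbert_space))"
proof (rule bounded_linear_intro[where K = "2 * norm y"])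
  fix x z :: 'h and r :: real
  show "cinner (x + z) y = cinner x y + cinner z y" by (rule cinner_add_left)
  show "cinner (r *\<^sub>R x) y = r *\<^sub>R cinner x y"
    by (simp add: scaleR_eq_scaleC cinner_scaleC_left scaleR_conv_of_real)
  have "cmod (cinner x y) \<le> \<bar>inner x y\<bar> + \<bar>inner x (\<i> *\<^sub>C y)\<bar>"
    unfolding cinner_eq_inner using cmod_le[of "Complex (inner x y) (inner x (\<i> *\<^sub>C y))"] by simp
  also have "\<dots> \<le> norm x * norm y + norm x * norm y"
    by (rule add_mono) (metis Cauchy_Schwarz_ineq2, metis Cauchy_Schwarz_ineq2 norm_scaleC norm_ii mult_1)
  finally show "norm (cinner x y) \<le> norm x * (2 * norm y)" by simp
qed

lemma sums_cinner_left: "f sums s \<Longrightarrow> (\<lambda>n. cinner (f n) y) sums cinner s (y :: 'h::chilbert_space)"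
  by (rule bounded_linear.sums[OF bounded_linear_cinner_left])

section \<open>Riesz representation and adjoints\<close>

text \<open>The representing vector minimises the functional \<open>x \<mapsto> \<parallel>x\<parallel>\<^sup>2 - 2 f x\<close>. By the parallelogram law a
  minimising sequence is Cauchy, and at its limit \<open>v\<close> the first variation \<open>\<langle>x, v\<rangle> - f x\<close> vanishes.\<close>

lemma riesz_representation:
  fixes f :: "'a::{real_inner,complete_space} \<Rightarrow> real"
  assumes f: "bounded_linear f"
  obtains v where "\<And>x. f x = inner x v"
proof -
  interpret f: bounded_linear f by (rule f)
  define E where "E x = (norm x)\<^sup>2 - 2 * f x" for x
  obtain K where K: "\<And>x. norm (f x) \<le> norm x * K" using f.bounded by blast
  have low: "- K\<^sup>2 \<le> E x" for x
  proof -
    have "f x \<le> norm x * K" using K[of x] by simp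
    moreover have "0 \<le> (norm x - K)\<^sup>2" by simp
    ultimately show ?thesis unfolding E_def power2_diff by linarith
  qed
  then have bdd: "bdd_below (range E)" by (auto intro!: bdd_belowI)
  define m where "m = (INF x. E x)"
  have m: "m \<le> E x" for x unfolding m_def by (rule cINF_lower[OF bdd]) simp
  have "\<exists>x. E x < m + inverse (real (Suc n))" for n
  proof -
    have "Inf (range E) < m + inverse (real (Suc n))" by (simp add: m_def)
    from cInf_lessD[OF _ this] show ?thesis by auto
  qed
  then obtain X where X: "\<And>n. E (X n) < m + inverse (real (Suc n))" by metis
  have par: "(norm (x - y))\<^sup>2 \<le> 2 * (E x - m) + 2 * (E y - m)" for x y
  proof -
    have "4 * E ((1/2) *\<^sub>R (x + y)) = (norm (x + y))\<^sup>2 - 4 * f (x + y)"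
      by (simp add: E_def f.scaleR power_divide del: scaleR_add_right)
    moreover have "(norm (x + y))\<^sup>2 + (norm (x - y))\<^sup>2 = 2 * (norm x)\<^sup>2 + 2 * (norm y)\<^sup>2"
      by (simp add: power2_norm_eq_inner inner_add_left inner_add_right inner_diff_left inner_diff_right)
    moreover have "m \<le> E ((1/2) *\<^sub>R (x + y))" by (rule m)
    ultimately show ?thesis unfolding E_def f.add by simp
  qed
  have "Cauchy X"
  proof (rule CauchyI)
    fix e :: real assume "e > 0"
    then obtain N where N: "inverse (real (Suc N)) < e\<^sup>2 / 4"
      using reals_Archimedean[of "e\<^sup>2 / 4"] by auto
    have "norm (X i - X j) < e" if "i \<ge> N" "j \<ge> N" for i j
    proof -
      have small: "E (X k) - m < e\<^sup>2 / 4" if "k \<ge> N" for k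
      proof -
        have "inverse (real (Suc k)) \<le> inverse (real (Suc N))" using that by (simp add: le_imp_inverse_le)
        then show ?thesis using X[of k] N by linarith
      qed
      have "2 * (E (X i) - m) + 2 * (E (X j) - m) < e\<^sup>2"
        using small[OF that(1)] small[OF that(2)] by (simp add: field_simps)
      with par[of "X i" "X j"] have "(norm (X i - X j))\<^sup>2 < e\<^sup>2"
        by (rule le_less_trans)
      then show ?thesis using \<open>e > 0\<close> by (simp add: power_less_imp_less_base)
    qed
    then show "\<exists>M. \<forall>m\<ge>M. \<forall>n\<ge>M. norm (X m - X n) < e" by blast
  qed
  then obtain v where v: "X \<longlonglongrightarrow> v" using Cauchy_convergent convergentD by blast
  have "(\<lambda>n. E (X n)) \<longlonglongrightarrow> E v"
    unfolding E_def by (intro tendsto_intros v f.tendsto)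
  moreover have "(\<lambda>n. m + inverse (real (Suc n))) \<longlonglongrightarrow> m + 0"
    by (intro tendsto_intros LIMSEQ_inverse_real_of_nat)
  ultimately have Ev: "E v \<le> m"
    using X by (intro LIMSEQ_le) (auto intro: less_imp_le)
  have "f x = inner x v" for x
  proof -
    define b where "b = inner x v - f x"
    have quad: "0 \<le> t\<^sup>2 * (norm x)\<^sup>2 + 2 * t * b" for t
    proof -
      have "E (v + t *\<^sub>R x) = E v + t\<^sup>2 * (norm x)\<^sup>2 + 2 * t * b"
        by (simp add: E_def b_def f.add f.scaleR power2_norm_eq_inner inner_add_left inner_add_right
            inner_commute algebra_simps power2_eq_square[of t])
      then show ?thesis using m[of "v + t *\<^sub>R x"] Ev by linarith
    qed
    have "b = 0"
    proof (rule ccontr)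
      assume "b \<noteq> 0"
      define D where "D = (norm x)\<^sup>2 + 1"
      have D: "D > 0" by (simp add: D_def add_nonneg_pos)
      \<comment> \<open>The step \<open>- b / D\<close> with \<open>D > \<parallel>x\<parallel>\<^sup>2 / 2\<close> makes the quadratic negative unless \<open>b = 0\<close>.\<close>
      have "(- b / D)\<^sup>2 * (norm x)\<^sup>2 + 2 * (- b / D) * b = (b / D)\<^sup>2 * ((norm x)\<^sup>2 - 2 * D)"
        using D by (simp add: power2_eq_square field_simps)
      moreover have "(norm x)\<^sup>2 - 2 * D < 0"
        using D unfolding D_def by argo
      moreover have "(b / D)\<^sup>2 > 0" using \<open>b \<noteq> 0\<close> D by simp
      ultimately show False
        using quad[of "- b / D"] by (metis mult_pos_neg not_le)
    qed
    then show ?thesis by (simp add: b_def)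
  qed
  then show ?thesis by (rule that)
qed

lemma bounded_opsD: "T \<in> bounded_ops \<Longrightarrow> blinfun_apply T (c *\<^sub>C x) = c *\<^sub>C T x"
  by (simp add: bounded_ops_def)

lemma bounded_ops_comp: "S \<in> bounded_ops \<Longrightarrow> T \<in> bounded_ops \<Longrightarrow> S o\<^sub>L T \<in> bounded_ops"
  by (simp add: bounded_ops_def)

lemma bounded_ops_add: "S \<in> bounded_ops \<Longrightarrow> T \<in> bounded_ops \<Longrightarrow> S + T \<in> bounded_ops"
  by (simp add: bounded_ops_def blinfun.add_left scaleC_add_right)

lemma bounded_ops_diff: "S \<in> bounded_ops \<Longrightarrow> T \<in> bounded_ops \<Longrightarrow> S - T \<in> bounded_ops"
  by (simp add: bounded_ops_def blinfun.diff_left scaleC_diff_right)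

lemma bounded_ops_scale: "T \<in> bounded_ops \<Longrightarrow> scale_op c T \<in> bounded_ops"
  by (simp add: bounded_ops_def scale_op_apply scaleC_scaleC mult.commute)

lemma bounded_ops_id: "id_blinfun \<in> bounded_ops"
  by (simp add: bounded_ops_def)

text \<open>This is what gives \<^const>\<open>adj\<close> its meaning: the real Riesz theorem yields the adjoint for the
  real inner product, and complex linearity of \<open>T\<close> upgrades it to the complex one.\<close>

lemma adj_exists:
  fixes T :: "'h::chilbert_space oper"
  assumes T: "T \<in> bounded_ops"
  shows "\<exists>!S. S \<in> bounded_ops \<and> (\<forall>x y. cinner (S x) y = cinner x (T y))"
proof -
  have "\<exists>v. \<forall>y. inner (T y) x = inner y v" for x
  proof -
    have "bounded_linear (\<lambda>y. inner (T y) x)"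
      by (intro bounded_linear_intros)
    then show ?thesis by (metis riesz_representation)
  qed
  then obtain S where S: "\<And>x y. inner (T y) x = inner y (S x)" by metis
  have c: "cinner (S x) y = cinner x (T y)" for x y
  proof -
    have "inner (S x) (\<i> *\<^sub>C y) = inner x (\<i> *\<^sub>C T y)"
      using S[of "\<i> *\<^sub>C y" x] by (simp add: bounded_opsD[OF T] inner_commute)
    then show ?thesis
      using S[of y x] by (simp add: cinner_eq_inner inner_commute)
  qed
  have add: "S (x + y) = S x + S y" for x y
    by (rule cinner_ext) (simp add: c cinner_add_left)
  have scale: "S (k *\<^sub>C x) = k *\<^sub>C S x" for x k
    by (rule cinner_ext) (simp add: c cinner_scaleC_left)
  have bound: "norm (S x) \<le> norm x * norm T" for x
  proof (cases "S x = 0")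
    case False
    have "norm (S x) * norm (S x) = inner (T (S x)) x"
      by (simp add: S norm_eq_sqrt_inner)
    also have "\<dots> \<le> norm (T (S x)) * norm x" by (rule norm_cauchy_schwarz)
    also have "\<dots> \<le> (norm T * norm (S x)) * norm x"
      by (intro mult_right_mono norm_blinfun) simp
    finally have "norm (S x) * norm (S x) \<le> norm (S x) * (norm x * norm T)"
      by (simp add: algebra_simps)
    then show ?thesis using False by simp
  qed simp
  have bl: "bounded_linear S"
    by (rule bounded_linear_intro[OF add _ bound]) (simp add: scaleR_eq_scaleC scale)
  show ?thesis
  proof (rule ex1I)
    show "Blinfun S \<in> bounded_ops \<and> (\<forall>x y. cinner (Blinfun S x) y = cinner x (T y))"
      by (simp add: bounded_ops_def bounded_linear_Blinfun_apply[OF bl] scale c)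
  next
    fix R :: "'h oper"
    assume R: "R \<in> bounded_ops \<and> (\<forall>x y. cinner (R x) y = cinner x (T y))"
    show "R = Blinfun S"
      by (intro blinfun_eqI cinner_ext) (simp add: bounded_linear_Blinfun_apply[OF bl] c R)
  qed
qed

lemma adj_in: "T \<in> bounded_ops \<Longrightarrow> adj T \<in> bounded_ops"
  and cinner_adj_left: "T \<in> bounded_ops \<Longrightarrow> cinner (blinfun_apply (adj T) x) y = cinner x (T y)"
  using theI'[OF adj_exists, of T] by (auto simp: adj_def)

lemma cinner_adj_right: "T \<in> bounded_ops \<Longrightarrow> cinner x (blinfun_apply (adj T) y) = cinner (T x) y"
  by (metis cinner_adj_left cinner_commute)

lemma adj_eqI:
  fixes S T :: "'h::chilbert_space oper"
  assumes "T \<in> bounded_ops" and "\<And>x y. cinner (S x) y = cinner x (T y)"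
  shows "adj T = S"
  by (intro blinfun_eqI cinner_ext) (simp add: assms cinner_adj_left)

lemma adj_adj: "T \<in> bounded_ops \<Longrightarrow> adj (adj T) = T"
  by (rule adj_eqI) (simp_all add: adj_in cinner_adj_right)

lemma adj_comp: "S \<in> bounded_ops \<Longrightarrow> T \<in> bounded_ops \<Longrightarrow> adj (S o\<^sub>L T) = adj T o\<^sub>L adj S"
  by (rule adj_eqI) (simp_all add: bounded_ops_comp cinner_adj_left)

lemma adj_add: "S \<in> bounded_ops \<Longrightarrow> T \<in> bounded_ops \<Longrightarrow> adj (S + T) = adj S + adj T"
  by (rule adj_eqI)
     (simp_all add: bounded_ops_add cinner_adj_left blinfun.add_left cinner_add_left cinner_add_right)

lemma adj_scale: "T \<in> bounded_ops \<Longrightarrow> adj (scale_op c T) = scale_op (cnj c) (adj T)"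
  by (rule adj_eqI)
     (simp_all add: bounded_ops_scale scale_op_apply cinner_adj_left cinner_scaleC_left cinner_scaleC_right)

lemma adj_id: "adj id_blinfun = id_blinfun"
  by (rule adj_eqI) (simp_all add: bounded_ops_id)

section \<open>The weak operator topology\<close>

text \<open>A linear relation between two matrix coefficients passes to the weak closure. With \<open>\<eta>' = 0\<close> it
  transports orthogonality to a vector, with \<open>\<xi>' = T \<xi>\<close> commutation with \<open>T\<close>.\<close>

lemma wot_closure_cinner_eq:
  fixes x :: "'h::chilbert_space oper"
  assumes x: "x \<in> weak_operator_topology closure_of A"
    and A: "\<And>y. y \<in> A \<Longrightarrow> cinner (y \<xi>) \<eta> = cinner (y \<xi>') \<eta>'"
  shows "cinner (x \<xi>) \<eta> = cinner (x \<xi>') \<eta>'"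
proof -
  let ?e = "\<lambda>(T :: 'h oper) (p :: 'h \<times> 'h). cinner (T (fst p)) (snd p)"
  have cont: "continuous_map weak_operator_topology euclidean (\<lambda>T. ?e T p)" for p
  proof -
    have "continuous_map euclidean euclidean (\<lambda>g :: 'h \<times> 'h \<Rightarrow> complex. g p)"
      by simp
    then have "continuous_map (pullback_topology UNIV ?e euclidean) euclidean ((\<lambda>g. g p) \<circ> ?e)"
      by (rule continuous_map_pullback)
    then show ?thesis
      by (simp add: weak_operator_topology_def o_def)
  qed
  let ?f = "\<lambda>T :: 'h oper. cinner (T \<xi>) \<eta> - cinner (T \<xi>') \<eta>'"
  have f: "continuous_map weak_operator_topology euclidean ?f"
    using continuous_map_diff[OF cont[of "(\<xi>, \<eta>)"] cont[of "(\<xi>', \<eta>')"]] by simp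
  have "?f ` (weak_operator_topology closure_of A) \<subseteq> closure (?f ` A)"
    using continuous_map_image_closure_subset[OF f] by simp
  moreover have "closure (?f ` A) \<subseteq> {0}"
    using A by (intro closure_minimal) auto
  ultimately have "?f x = 0" using x by blast
  then show ?thesis by simp
qed

section \<open>Sandwich maps of isometric columns\<close>

instance chilbert_space \<subseteq> banach ..

text \<open>The row of the adjoints of a contractive column is contractive; by duality, \<open>\<parallel>w\<parallel>\<^sup>2\<close> for
  \<open>w = (\<Sum>n\<in>F. d n (v n))\<close> is at most \<open>\<parallel>v\<parallel> \<parallel>w\<parallel>\<close> by the Cauchy-Schwarz inequality.\<close>

lemma row_contraction:
  fixes c d :: "nat \<Rightarrow> 'a::real_inner \<Rightarrow>\<^sub>L 'a"
  assumes adj: "\<And>n x y. inner (d n x) y = inner x (c n y)"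
    and contr: "\<And>F \<xi>. finite F \<Longrightarrow> (\<Sum>n\<in>F. (norm (c n \<xi>))\<^sup>2) \<le> (norm \<xi>)\<^sup>2"
    and F: "finite F"
  shows "(norm (\<Sum>n\<in>F. d n (v n)))\<^sup>2 \<le> (\<Sum>n\<in>F. (norm (v n))\<^sup>2)"
proof -
  define w where "w = (\<Sum>n\<in>F. d n (v n))"
  have "(norm w)\<^sup>2 = (\<Sum>n\<in>F. inner (v n) (c n w))"
    unfolding power2_norm_eq_inner by (subst (1) w_def) (simp add: inner_sum_left adj)
  also have "\<dots> \<le> (\<Sum>n\<in>F. \<bar>norm (v n)\<bar> * \<bar>norm (c n w)\<bar>)"
    by (rule sum_mono) (simp add: norm_cauchy_schwarz)
  also have "\<dots> \<le> L2_set (\<lambda>n. norm (v n)) F * L2_set (\<lambda>n. norm (c n w)) F"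
    by (rule L2_set_mult_ineq)
  also have "\<dots> \<le> L2_set (\<lambda>n. norm (v n)) F * norm w"
    using contr[OF F, of w]
    by (intro mult_left_mono) (auto simp: L2_set_def intro: real_le_lsqrt sum_nonneg)
  finally have "norm w * norm w \<le> L2_set (\<lambda>n. norm (v n)) F * norm w"
    by (simp add: power2_eq_square)
  then have "norm w \<le> L2_set (\<lambda>n. norm (v n)) F"
    by (cases "w = 0") (auto simp: L2_set_def sum_nonneg)
  then have "(norm w)\<^sup>2 \<le> (L2_set (\<lambda>n. norm (v n)) F)\<^sup>2"
    by (simp add: power_mono)
  then show ?thesis
    by (simp add: w_def L2_set_def sum_nonneg)
qed

text \<open>Contractivity of the row turns square summability of \<open>\<parallel>c n \<xi>\<parallel>\<close> into strong convergence of
  \<open>\<Sum>n. (c n)\<^sup>* T (c n) \<xi>\<close>.\<close>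

lemma sandwich_exists:
  fixes c d :: "nat \<Rightarrow> 'h::chilbert_space oper"
  assumes d: "\<And>n. d n \<in> bounded_ops" and c: "\<And>n. c n \<in> bounded_ops"
    and adj: "\<And>n x y. cinner (d n x) y = cinner x (c n y)"
    and contr: "\<And>F \<xi>. finite F \<Longrightarrow> (\<Sum>n\<in>F. (norm (c n \<xi>))\<^sup>2) \<le> (norm \<xi>)\<^sup>2"
    and T: "T \<in> bounded_ops"
  shows "\<exists>S\<in>bounded_ops. \<forall>\<xi>. (\<lambda>n. d n (T (c n \<xi>))) sums S \<xi>"
proof -
  have adj': "inner (d n x) y = inner x (c n y)" for n x y
    by (simp add: inner_eq_Re_cinner adj)
  have row: "(norm (\<Sum>n\<in>F. d n (v n)))\<^sup>2 \<le> (\<Sum>n\<in>F. (norm (v n))\<^sup>2)" if "finite F" for F v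
    by (rule row_contraction[OF adj' contr that])
  have sm: "summable (\<lambda>n. d n (T (c n \<xi>)))" for \<xi>
    unfolding summable_Cauchy
  proof (intro allI impI)
    fix e :: real assume "e > 0"
    have "summable (\<lambda>n. (norm T)\<^sup>2 * (norm (c n \<xi>))\<^sup>2)"
      by (intro summable_mult summableI_nonneg_bounded[where x = "(norm \<xi>)\<^sup>2"] contr) auto
    then obtain N where N: "\<And>m n. m \<ge> N \<Longrightarrow> norm (\<Sum>k=m..<n. (norm T)\<^sup>2 * (norm (c k \<xi>))\<^sup>2) < e\<^sup>2"
      using \<open>e > 0\<close> unfolding summable_Cauchy by (meson zero_less_power)
    have "norm (\<Sum>k=m..<n. d k (T (c k \<xi>))) < e" if "m \<ge> N" for m n
    proof -
      have "(norm (\<Sum>k=m..<n. d k (T (c k \<xi>))))\<^sup>2 \<le> (\<Sum>k=m..<n. (norm (T (c k \<xi>)))\<^sup>2)"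
        by (rule row) simp
      also have "\<dots> \<le> (\<Sum>k=m..<n. (norm T)\<^sup>2 * (norm (c k \<xi>))\<^sup>2)"
        by (auto intro!: sum_mono power_mono norm_blinfun simp flip: power_mult_distrib)
      also have "\<dots> < e\<^sup>2" using N[OF that, of n] by simp
      finally show ?thesis using \<open>e > 0\<close> by (simp add: power_less_imp_less_base)
    qed
    then show "\<exists>N. \<forall>m\<ge>N. \<forall>n. norm (\<Sum>k=m..<n. d k (T (c k \<xi>))) < e" by blast
  qed
  define g where "g \<xi> = (\<Sum>n. d n (T (c n \<xi>)))" for \<xi>
  have g: "(\<lambda>n. d n (T (c n \<xi>))) sums g \<xi>" for \<xi>
    unfolding g_def by (rule summable_sums[OF sm])
  have add: "g (x + y) = g x + g y" for x y
    using sums_add[OF g[of x] g[of y]] g[of "x + y"]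
    by (simp add: blinfun.add_right sums_unique2)
  have scale: "g (k *\<^sub>C x) = k *\<^sub>C g x" for k x
    using bounded_linear.sums[OF bounded_linear_scaleC g, of k x] g[of "k *\<^sub>C x"]
    by (simp add: bounded_opsD d c T sums_unique2)
  have bound: "norm (g x) \<le> norm x * norm T" for x
  proof (rule LIMSEQ_le_const2)
    show "(\<lambda>N. norm (\<Sum>n<N. d n (T (c n x)))) \<longlonglongrightarrow> norm (g x)"
      using g unfolding sums_def by (rule tendsto_norm)
    have "norm (\<Sum>n<N. d n (T (c n x))) \<le> norm x * norm T" for N
    proof (rule power2_le_imp_le)
      have "(norm (\<Sum>n<N. d n (T (c n x))))\<^sup>2 \<le> (\<Sum>n<N. (norm (T (c n x)))\<^sup>2)"
        by (rule row) simp
      also have "\<dots> \<le> (\<Sum>n<N. (norm T)\<^sup>2 * (norm (c n x))\<^sup>2)"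
        by (auto intro!: sum_mono power_mono norm_blinfun simp flip: power_mult_distrib)
      also have "\<dots> \<le> (norm T)\<^sup>2 * (norm x)\<^sup>2"
        unfolding sum_distrib_left[symmetric] by (intro mult_left_mono contr) auto
      finally show "(norm (\<Sum>n<N. d n (T (c n x))))\<^sup>2 \<le> (norm x * norm T)\<^sup>2"
        by (simp add: power_mult_distrib mult.commute)
    qed simp
    then show "\<exists>N. \<forall>n\<ge>N. norm (\<Sum>n<n. d n (T (c n x))) \<le> norm x * norm T" by blast
  qed
  have bl: "bounded_linear g"
    by (rule bounded_linear_intro[OF add _ bound]) (simp add: scaleR_eq_scaleC scale)
  show ?thesis
    by (rule bexI[of _ "Blinfun g"])
       (auto simp: bounded_ops_def bounded_linear_Blinfun_apply[OF bl] scale g)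
qed

text \<open>The map \<open>T \<mapsto> (\<Sum>n. d n T (c n))\<close>, the series converging strongly.\<close>

definition sandwich ::
  "(nat \<Rightarrow> 'h::chilbert_space oper) \<Rightarrow> (nat \<Rightarrow> 'h oper) \<Rightarrow> 'h oper \<Rightarrow> 'h oper" where
  "sandwich d c T = (SOME S. S \<in> bounded_ops \<and> (\<forall>\<xi>. (\<lambda>n. d n (T (c n \<xi>))) sums S \<xi>))"

lemma column_isometry_contraction:
  assumes "column_isometry c" "finite F"
  shows "(\<Sum>n\<in>F. (norm (c n \<xi>))\<^sup>2) \<le> (norm \<xi>)\<^sup>2"
  using assms sum_le_suminf[of "\<lambda>n. (norm (c n \<xi>))\<^sup>2" F]
  by (auto simp: column_isometry_def sums_iff)

lemma
  fixes c d :: "nat \<Rightarrow> 'h::chilbert_space oper"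
  assumes d: "\<And>n. d n \<in> bounded_ops" and c: "\<And>n. c n \<in> bounded_ops"
    and adj: "\<And>n x y. cinner (d n x) y = cinner x (c n y)"
    and iso: "column_isometry c"
    and T: "T \<in> bounded_ops"
  shows sandwich_in: "sandwich d c T \<in> bounded_ops"
    and sandwich_sums: "(\<lambda>n. d n (T (c n \<xi>))) sums sandwich d c T \<xi>"
proof -
  have "\<exists>S. S \<in> bounded_ops \<and> (\<forall>\<xi>. (\<lambda>n. d n (T (c n \<xi>))) sums S \<xi>)"
    using sandwich_exists[OF d c adj column_isometry_contraction[OF iso] T] by blast
  from someI_ex[OF this]
  show "sandwich d c T \<in> bounded_ops" "(\<lambda>n. d n (T (c n \<xi>))) sums sandwich d c T \<xi>"
    by (auto simp: sandwich_def)
qed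

text \<open>Complete positivity holds because a matrix coefficient of the image is the sum over \<open>n\<close> of the
  values of the original positive form at the vectors \<open>c n (\<xi> i)\<close>, and unitality because the
  column is isometric.\<close>

lemma sandwich_ucp:
  fixes c d :: "nat \<Rightarrow> 'h::chilbert_space oper"
  assumes d: "\<And>n. d n \<in> bounded_ops" and c: "\<And>n. c n \<in> bounded_ops"
    and adj: "\<And>n x y. cinner (d n x) y = cinner x (c n y)"
    and iso: "column_isometry c"
    and P: "\<And>T. T \<in> bounded_ops \<Longrightarrow> P T = sandwich d c T"
  shows "ucp P"
proof -
  note S_in = sandwich_in[OF d c adj iso] and S_sums = sandwich_sums[OF d c adj iso]
  have quad: "(\<lambda>n. cinner (T (c n \<xi>)) (c n \<eta>)) sums cinner (sandwich d c T \<xi>) \<eta>"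
    if "T \<in> bounded_ops" for T \<xi> \<eta>
    using sums_cinner_left[OF S_sums[OF that]] by (simp add: adj)
  show ?thesis
    unfolding ucp_def
  proof (intro conjI ballI allI impI)
    show "P \<in> bounded_ops \<rightarrow> bounded_ops" using S_in P by simp
  next
    fix S T :: "'h oper" assume *: "S \<in> bounded_ops" "T \<in> bounded_ops"
    show "P (S + T) = P S + P T"
    proof (rule blinfun_eqI)
      fix \<xi>
      show "P (S + T) \<xi> = (P S + P T) \<xi>"
        using sums_add[OF S_sums[OF *(1), of \<xi>] S_sums[OF *(2), of \<xi>]]
          S_sums[OF bounded_ops_add[OF *], of \<xi>] *
        by (simp add: P bounded_ops_add blinfun.add_left blinfun.add_right sums_unique2)
    qed
  next
    fix k and T :: "'h oper" assume T: "T \<in> bounded_ops"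
    show "P (scale_op k T) = scale_op k (P T)"
    proof (rule blinfun_eqI)
      fix \<xi>
      show "P (scale_op k T) \<xi> = scale_op k (P T) \<xi>"
        using bounded_linear.sums[OF bounded_linear_scaleC S_sums[OF T], of k \<xi>]
          S_sums[OF bounded_ops_scale[OF T], of k \<xi>] T
        by (simp add: P bounded_ops_scale scale_op_apply bounded_opsD[OF d] sums_unique2)
    qed
  next
    have sq: "cinner (P id_blinfun \<xi>) \<xi> = cinner \<xi> \<xi>" for \<xi>
    proof (rule sums_unique2)
      show "(\<lambda>n. cinner (c n \<xi>) (c n \<xi>)) sums cinner (P id_blinfun \<xi>) \<xi>"
        using quad[OF bounded_ops_id] by (simp add: P bounded_ops_id)
      show "(\<lambda>n. cinner (c n \<xi>) (c n \<xi>)) sums cinner \<xi> \<xi>"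
        using iso unfolding cinner_self sums_of_real_iff by (simp add: column_isometry_def)
    qed
    have "P id_blinfun \<xi> = \<xi>" for \<xi>
    proof -
      define R where "R = P id_blinfun - id_blinfun"
      have R: "R \<in> bounded_ops"
        unfolding R_def by (intro bounded_ops_diff bounded_ops_id) (simp add: P bounded_ops_id S_in)
      have R0: "cinner (R \<xi>) \<xi> = 0" for \<xi>
        by (simp add: R_def blinfun.diff_left cinner_diff_left sq)
      \<comment> \<open>The quadratic form of the complex-linear \<open>R\<close> vanishes, so \<open>R = 0\<close> by polarisation.\<close>
      have "cinner (R \<xi>) \<eta> = 0" for \<xi> \<eta>
      proof -
        have "cinner (R \<xi>) \<eta> + cinner (R \<eta>) \<xi> = 0"
          using R0[of "\<xi> + \<eta>"]
          by (simp add: blinfun.add_right cinner_add_left cinner_add_right R0 add.commute)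
        moreover have "\<i> * (cinner (R \<eta>) \<xi> - cinner (R \<xi>) \<eta>) = 0"
          using R0[of "\<xi> + \<i> *\<^sub>C \<eta>"]
          by (simp add: blinfun.add_right cinner_add_left cinner_add_right R0 bounded_opsD[OF R]
              cinner_scaleC_left cinner_scaleC_right algebra_simps)
        ultimately show ?thesis by simp
      qed
      then have "R \<xi> = 0" by (intro cinner_ext) simp
      then show ?thesis by (simp add: R_def blinfun.diff_left)
    qed
    then show "P id_blinfun = id_blinfun" by (intro blinfun_eqI) simp
  next
    fix n and T :: "nat \<Rightarrow> nat \<Rightarrow> 'h oper"
    assume pos: "positive_matrix n T"
    then have T: "\<And>i j. i < n \<Longrightarrow> j < n \<Longrightarrow> T i j \<in> bounded_ops"
      by (simp add: positive_matrix_def)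
    show "positive_matrix n (\<lambda>i j. P (T i j))"
      unfolding positive_matrix_def
    proof (intro conjI allI impI)
      fix i j assume "i < n" "j < n"
      then show "P (T i j) \<in> bounded_ops" using T P S_in by simp
    next
      fix \<xi> :: "nat \<Rightarrow> 'h"
      have "(\<lambda>k. \<Sum>i<n. \<Sum>j<n. cinner (T i j (c k (\<xi> j))) (c k (\<xi> i)))
          sums (\<Sum>i<n. \<Sum>j<n. cinner (P (T i j) (\<xi> j)) (\<xi> i))"
        by (intro sums_sum) (simp add: P T quad)
      moreover have "(\<Sum>k<N. \<Sum>i<n. \<Sum>j<n. cinner (T i j (c k (\<xi> j))) (c k (\<xi> i))) \<in> \<real>\<^sub>\<ge>\<^sub>0" for N
        using pos unfolding positive_matrix_def
        by (induction N) (auto intro!: nonneg_Reals_add_I)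
      ultimately show "(\<Sum>i<n. \<Sum>j<n. cinner (P (T i j) (\<xi> j)) (\<xi> i)) \<in> \<real>\<^sub>\<ge>\<^sub>0"
        unfolding sums_def by (intro Lim_in_closed_set[OF closed_nonneg_Reals_complex]) auto
    qed
  qed
qed

text \<open>Finite partial sums are continuous, so contractivity passes from \<open>D\<close> to its closure; it makes
  \<open>R = (\<Sum>n. (c n)\<^sup>* (c n))\<close> a bounded operator, and then also \<open>\<langle>R \<xi>, \<xi>\<rangle> = \<parallel>\<xi>\<parallel>\<^sup>2\<close> passes to the closure.\<close>

lemma column_isometry_dense:
  fixes c d :: "nat \<Rightarrow> 'h::chilbert_space oper"
  assumes d: "\<And>n. d n \<in> bounded_ops" and c: "\<And>n. c n \<in> bounded_ops"
    and adj: "\<And>n x y. cinner (d n x) y = cinner x (c n y)"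
    and D: "closure D = UNIV"
    and iso: "\<And>\<xi>. \<xi> \<in> D \<Longrightarrow> (\<lambda>n. (norm (c n \<xi>))\<^sup>2) sums (norm \<xi>)\<^sup>2"
  shows "column_isometry c"
proof -
  have contr: "(\<Sum>n\<in>F. (norm (c n \<xi>))\<^sup>2) \<le> (norm \<xi>)\<^sup>2" if "finite F" for F \<xi>
  proof -
    have "closed {\<xi>. (\<Sum>n\<in>F. (norm (c n \<xi>))\<^sup>2) \<le> (norm \<xi>)\<^sup>2}"
      by (intro closed_Collect_le continuous_intros)
    moreover have "D \<subseteq> {\<xi>. (\<Sum>n\<in>F. (norm (c n \<xi>))\<^sup>2) \<le> (norm \<xi>)\<^sup>2}"
    proof safe
      fix \<xi> assume "\<xi> \<in> D"
      with iso sum_le_suminf[of "\<lambda>n. (norm (c n \<xi>))\<^sup>2" F] that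
      show "(\<Sum>n\<in>F. (norm (c n \<xi>))\<^sup>2) \<le> (norm \<xi>)\<^sup>2" by (auto simp: sums_iff)
    qed
    ultimately have "closure D \<subseteq> {\<xi>. (\<Sum>n\<in>F. (norm (c n \<xi>))\<^sup>2) \<le> (norm \<xi>)\<^sup>2}"
      by (intro closure_minimal)
    with D show ?thesis by auto
  qed
  obtain R :: "'h oper" where R: "\<And>\<xi>. (\<lambda>n. d n (c n \<xi>)) sums R \<xi>" and "R \<in> bounded_ops"
    using sandwich_exists[OF d c adj contr bounded_ops_id] by auto
  have Rsq: "(\<lambda>n. (norm (c n \<xi>))\<^sup>2) sums Re (cinner (R \<xi>) \<xi>)" for \<xi>
    using bounded_linear.sums[OF bounded_linear_Re sums_cinner_left[OF R, of \<xi> \<xi>]]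
    by (simp add: adj cinner_self)
  have "closed {\<xi>. Re (cinner (R \<xi>) \<xi>) = (norm \<xi>)\<^sup>2}"
    by (intro closed_Collect_eq continuous_intros)
  moreover have "D \<subseteq> {\<xi>. Re (cinner (R \<xi>) \<xi>) = (norm \<xi>)\<^sup>2}"
    using iso Rsq by (auto intro: sums_unique2)
  ultimately have "closure D \<subseteq> {\<xi>. Re (cinner (R \<xi>) \<xi>) = (norm \<xi>)\<^sup>2}"
    by (intro closure_minimal)
  then show ?thesis
    using D Rsq unfolding column_isometry_def by (auto simp: subset_iff)
qed

section \<open>Commutants\<close>

lemma blinfun_compose_assoc: "(S o\<^sub>L T) o\<^sub>L R = S o\<^sub>L (T o\<^sub>L R)"
  by (rule blinfun_eqI) simp

lemma id_blinfun_compose [simp]: "id_blinfun o\<^sub>L T = T" "T o\<^sub>L id_blinfun = T"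
  by (rule blinfun_eqI; simp)+

lemma commutant_apply:
  fixes A :: "'h::chilbert_space oper set"
  assumes "T \<in> commutant A" "x \<in> A"
  shows "T (x \<xi>) = x (T \<xi>)"
proof -
  have "T o\<^sub>L x = x o\<^sub>L T" using assms by (simp add: commutant_def)
  from arg_cong[OF this, of "\<lambda>R. blinfun_apply R \<xi>"] show ?thesis by simp
qed

lemma commutantI:
  fixes A :: "'h::chilbert_space oper set"
  assumes "T \<in> bounded_ops" "\<And>x \<xi>. x \<in> A \<Longrightarrow> T (x \<xi>) = x (T \<xi>)"
  shows "T \<in> commutant A"
  unfolding commutant_def using assms by (auto intro: blinfun_eqI)

lemma commutant_comp:
  fixes A :: "'h::chilbert_space oper set"
  assumes "S \<in> commutant A" "T \<in> commutant A"
  shows "S o\<^sub>L T \<in> commutant A"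
proof (rule commutantI)
  show "S o\<^sub>L T \<in> bounded_ops"
    using assms by (simp add: commutant_def bounded_ops_comp)
qed (simp add: commutant_apply[OF assms(1)] commutant_apply[OF assms(2)])

section \<open>The standard representation of a tracial von Neumann algebra\<close>

locale tracial_L2 =
  fixes M :: "'h::chilbert_space oper set"
    and \<tau> :: "'h oper \<Rightarrow> complex"
    and hat :: "'h oper \<Rightarrow> 'h"
  assumes tracial: "tracial_von_neumann_algebra M \<tau>"
    and L2: "L2_representation M \<tau> hat"
begin

abbreviation \<Omega> :: 'h where "\<Omega> \<equiv> hat id_blinfun"

abbreviation J :: "'h oper" where "J \<equiv> conjugation M hat"

lemma M_bounded: "x \<in> M \<Longrightarrow> x \<in> bounded_ops"
  and M_id: "id_blinfun \<in> M"
  and M_add: "x \<in> M \<Longrightarrow> y \<in> M \<Longrightarrow> x + y \<in> M"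
  and M_comp: "x \<in> M \<Longrightarrow> y \<in> M \<Longrightarrow> x o\<^sub>L y \<in> M"
  and M_scale: "x \<in> M \<Longrightarrow> scale_op c x \<in> M"
  and M_adj: "x \<in> M \<Longrightarrow> adj x \<in> M"
  and bicommutant: "commutant (commutant M) = M"
  using tracial
  by (auto simp: tracial_von_neumann_algebra_def von_neumann_algebra_def unital_subalgebra_def)

lemma hat_eq: "x \<in> M \<Longrightarrow> hat x = x \<Omega>"
  using L2 M_id by (simp add: L2_representation_def)

lemma hat_comp: "x \<in> M \<Longrightarrow> y \<in> M \<Longrightarrow> x (hat y) = hat (x o\<^sub>L y)"
  using L2 by (auto simp: L2_representation_def)

lemma hat_dense: "closure (hat ` M) = UNIV"
  using L2 by (simp add: L2_representation_def)

lemma cinner_hat: "x \<in> M \<Longrightarrow> y \<in> M \<Longrightarrow> cinner (hat x) (hat y) = \<tau> (adj y o\<^sub>L x)"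
  using L2 by (simp add: L2_representation_def)

lemma trace_commute: "x \<in> M \<Longrightarrow> y \<in> M \<Longrightarrow> \<tau> (x o\<^sub>L y) = \<tau> (y o\<^sub>L x)"
  using tracial by (simp add: tracial_von_neumann_algebra_def)

lemma dense_eqI:
  fixes f g :: "'h \<Rightarrow> 'b::t2_space"
  assumes "continuous_on UNIV f" "continuous_on UNIV g" "\<And>x. x \<in> M \<Longrightarrow> f (hat x) = g (hat x)"
  shows "f \<xi> = g \<xi>"
proof -
  have "closure (hat ` M) \<subseteq> {\<xi>. f \<xi> = g \<xi>}"
    using assms by (intro closure_minimal closed_Collect_eq) auto
  then show ?thesis using hat_dense by auto
qed

lemma oper_eqI:
  fixes S T :: "'h oper"
  assumes "\<And>x. x \<in> M \<Longrightarrow> S (hat x) = T (hat x)"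
  shows "S = T"
proof (rule blinfun_eqI)
  show "S \<xi> = T \<xi>" for \<xi>
    by (rule dense_eqI[where f = "blinfun_apply S" and g = "blinfun_apply T"])
       (intro linear_continuous_on blinfun.bounded_linear_right assms)+
qed

lemma hat_add: "x \<in> M \<Longrightarrow> y \<in> M \<Longrightarrow> hat (x + y) = hat x + hat y"
  using L2 by (simp add: L2_representation_def)

lemma hat_scale: "x \<in> M \<Longrightarrow> hat (scale_op c x) = c *\<^sub>C hat x"
  using L2 by (simp add: L2_representation_def)

lemma norm_hat_adj: "x \<in> M \<Longrightarrow> norm (hat (adj x)) = norm (hat x)"
proof -
  assume x: "x \<in> M"
  have "cinner (hat (adj x)) (hat (adj x)) = cinner (hat x) (hat x)"
    using trace_commute[OF x M_adj[OF x]] by (simp add: cinner_hat M_adj x adj_adj M_bounded)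
  then show ?thesis
    by (simp add: cinner_self del: of_real_power)
qed

lemma hat_adj_dist:
  assumes x: "x \<in> M" and y: "y \<in> M"
  shows "dist (hat (adj x)) (hat (adj y)) = dist (hat x) (hat y)"
proof -
  have neg: "hat (scale_op (-1) z) = - hat z" "hat (adj (scale_op (-1) z)) = - hat (adj z)" if "z \<in> M" for z
  proof -
    have m: "(-1) *\<^sub>C v = - v" for v :: 'h
      using scaleR_eq_scaleC[of "-1" v] by simp
    show "hat (scale_op (-1) z) = - hat z" "hat (adj (scale_op (-1) z)) = - hat (adj z)"
      using that by (simp_all add: hat_scale m adj_scale M_bounded M_adj)
  qed
  have "norm (hat (adj (x + scale_op (-1) y))) = norm (hat (x + scale_op (-1) y))"
    by (rule norm_hat_adj) (intro M_add M_scale x y)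
  then show ?thesis
    using x y by (simp add: adj_add M_bounded M_scale hat_add M_adj neg dist_norm)
qed

text \<open>The trace makes \<open>hat x \<mapsto> hat (adj x)\<close> isometric on the dense subspace \<open>hat ` M\<close>, so it extends
  uniquely to the whole space.\<close>

lemma conjugation_exists: "\<exists>!J :: 'h oper. \<forall>x\<in>M. J (hat x) = hat (adj x)"
proof -
  define j where "j v = hat (adj (SOME x. x \<in> M \<and> hat x = v))" for v
  have j: "j (hat x) = hat (adj x)" if "x \<in> M" for x
  proof -
    have "(SOME y. y \<in> M \<and> hat y = hat x) \<in> M \<and> hat (SOME y. y \<in> M \<and> hat y = hat x) = hat x"
      using that by (intro someI[of "\<lambda>y. y \<in> M \<and> hat y = hat x"]) simp
    then show ?thesis
      unfolding j_def using hat_adj_dist[OF _ that] by (metis dist_self dist_eq_0_iff)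
  qed
  have j_dist: "dist (j u) (j v) = dist u v" if uv: "u \<in> hat ` M" "v \<in> hat ` M" for u v
  proof -
    obtain x y where "x \<in> M" "u = hat x" "y \<in> M" "v = hat y"
      using uv by blast
    then show ?thesis by (simp only: j hat_adj_dist)
  qed
  have "uniformly_continuous_on (hat ` M) j"
    unfolding uniformly_continuous_on_def
  proof (intro allI impI)
    fix e :: real assume "e > 0"
    then show "\<exists>d>0. \<forall>x\<in>hat ` M. \<forall>x'\<in>hat ` M. dist x' x < d \<longrightarrow> dist (j x') (j x) < e"
      by (intro exI[of _ e] conjI ballI impI) (simp_all only: j_dist)
  qed
  from uniformly_continuous_on_extension_on_closure[OF this]
  obtain g where g: "uniformly_continuous_on (closure (hat ` M)) g"
    and gj: "\<And>v. v \<in> hat ` M \<Longrightarrow> j v = g v"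
    by metis
  have cont: "continuous_on UNIV g"
    using g hat_dense by (simp add: uniformly_continuous_imp_continuous)
  have gc: "continuous_on UNIV (\<lambda>x. g (h x))" if "continuous_on UNIV h" for h
    using continuous_on_compose2[OF cont that] by simp
  have g_hat: "g (hat x) = hat (adj x)" if "x \<in> M" for x
    using gj[of "hat x"] j[OF that] that by simp
  have add: "g (u + v) = g u + g v" for u v
  proof (rule dense_eqI[where f = "\<lambda>u. g (u + v)" and g = "\<lambda>u. g u + g v"])
    fix x assume x: "x \<in> M"
    show "g (hat x + v) = g (hat x) + g v"
    proof (rule dense_eqI[where f = "\<lambda>v. g (hat x + v)" and g = "\<lambda>v. g (hat x) + g v"])
      fix y assume y: "y \<in> M"
      have "g (hat (x + y)) = g (hat x) + g (hat y)"
        using x y by (simp only: g_hat M_add) (simp add: adj_add M_bounded hat_add M_adj)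
      then show "g (hat x + hat y) = g (hat x) + g (hat y)"
        by (simp add: hat_add x y)
    qed (intro continuous_intros gc)+
  qed (intro continuous_intros gc)+
  have scale: "g (c *\<^sub>C v) = cnj c *\<^sub>C g v" for c v
  proof (rule dense_eqI[where f = "\<lambda>v. g (c *\<^sub>C v)" and g = "\<lambda>v. cnj c *\<^sub>C g v"])
    fix x assume x: "x \<in> M"
    have "g (hat (scale_op c x)) = cnj c *\<^sub>C g (hat x)"
      using x by (simp only: g_hat M_scale) (simp add: adj_scale M_bounded hat_scale M_adj)
    then show "g (c *\<^sub>C hat x) = cnj c *\<^sub>C g (hat x)"
      by (simp add: hat_scale x)
  qed (intro continuous_intros gc)+
  have bound: "norm (g v) = norm v" for v
    by (rule dense_eqI[where f = "\<lambda>v. norm (g v)" and g = norm])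
       (auto intro!: continuous_intros gc simp: g_hat norm_hat_adj)
  have bl: "bounded_linear g"
    by (rule bounded_linear_intro[where K = 1, OF add])
       (simp_all add: scaleR_eq_scaleC scale bound)
  show ?thesis
  proof (rule ex1I)
    show "\<forall>x\<in>M. Blinfun g (hat x) = hat (adj x)"
      by (simp add: bounded_linear_Blinfun_apply[OF bl] g_hat)
  next
    fix K :: "'h oper" assume "\<forall>x\<in>M. K (hat x) = hat (adj x)"
    then show "K = Blinfun g"
      by (intro oper_eqI) (simp add: bounded_linear_Blinfun_apply[OF bl] g_hat)
  qed
qed

lemma J_hat:
  assumes x: "x \<in> M"
  shows "J (hat x) = hat (adj x)"
proof -
  have "\<forall>x\<in>M. J (hat x) = hat (adj x)"
    unfolding conjugation_def by (rule theI'[OF conjugation_exists])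
  then show ?thesis using x by (rule bspec)
qed

lemma J_J [simp]: "J (J \<xi>) = \<xi>"
proof (rule dense_eqI[where f = "\<lambda>\<xi>. J (J \<xi>)" and g = "\<lambda>\<xi>. \<xi>"])
  fix x assume "x \<in> M"
  then show "J (J (hat x)) = hat x"
    by (simp add: J_hat M_adj adj_adj M_bounded)
qed (intro continuous_intros)+

lemma J_scale: "J (c *\<^sub>C \<xi>) = cnj c *\<^sub>C J \<xi>"
proof (rule dense_eqI[where f = "\<lambda>v. J (c *\<^sub>C v)" and g = "\<lambda>v. cnj c *\<^sub>C J v"])
  fix x assume x: "x \<in> M"
  have "J (hat (scale_op c x)) = cnj c *\<^sub>C J (hat x)"
    using x by (simp only: J_hat M_scale) (simp add: adj_scale M_bounded hat_scale M_adj)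
  then show "J (c *\<^sub>C hat x) = cnj c *\<^sub>C J (hat x)"
    by (simp add: hat_scale x)
qed (intro continuous_intros)+

lemma cinner_J_J: "cinner (J \<xi>) (J \<eta>) = cinner \<eta> \<xi>"
proof (rule dense_eqI[where f = "\<lambda>\<xi>. cinner (J \<xi>) (J \<eta>)" and g = "\<lambda>\<xi>. cinner \<eta> \<xi>"])
  fix x assume x: "x \<in> M"
  show "cinner (J (hat x)) (J \<eta>) = cinner \<eta> (hat x)"
  proof (rule dense_eqI[where f = "\<lambda>\<eta>. cinner (J (hat x)) (J \<eta>)" and g = "\<lambda>\<eta>. cinner \<eta> (hat x)"])
    fix y assume y: "y \<in> M"
    show "cinner (J (hat x)) (J (hat y)) = cinner (hat y) (hat x)"
      using trace_commute[OF y M_adj[OF x]]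
      by (simp add: J_hat x y cinner_hat M_adj adj_adj M_bounded)
  qed (intro continuous_intros)+
qed (intro continuous_intros)+

lemma cinner_J_left: "cinner (J \<xi>) \<eta> = cinner (J \<eta>) \<xi>"
  using cinner_J_J[of \<xi> "J \<eta>"] by simp

lemma norm_J [simp]: "norm (J \<xi>) = norm \<xi>"
  using cinner_J_J[of \<xi> \<xi>] by (simp add: cinner_self del: of_real_power)

lemma J_\<Omega> [simp]: "J \<Omega> = \<Omega>"
  by (simp add: J_hat M_id adj_id)

lemma AdJ_apply [simp]: "AdJ M hat T \<xi> = J (T (J \<xi>))"
  by (simp add: AdJ_def)

lemma AdJ_bounded: "T \<in> bounded_ops \<Longrightarrow> AdJ M hat T \<in> bounded_ops"
  by (simp add: bounded_ops_def J_scale)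

lemma cinner_AdJ_adj:
  assumes "T \<in> bounded_ops"
  shows "cinner (AdJ M hat (adj T) \<xi>) \<eta> = cinner \<xi> (AdJ M hat T \<eta>)"
proof -
  have "cinner (J (adj T (J \<xi>))) \<eta> = cinner (J \<eta>) (adj T (J \<xi>))"
    by (rule cinner_J_left)
  also have "\<dots> = cinner (T (J \<eta>)) (J \<xi>)"
    by (rule cinner_adj_right[OF assms])
  also have "\<dots> = cinner (J (J \<xi>)) (J (T (J \<eta>)))"
    by (simp only: cinner_J_J)
  finally show ?thesis by simp
qed

text \<open>\<open>J x J\<close> is right multiplication by \<open>x\<^sup>*\<close>; this is why it commutes with the left multiplications.\<close>

lemma AdJ_hat:
  assumes x: "x \<in> M" and y: "y \<in> M"
  shows "AdJ M hat x (hat y) = hat (y o\<^sub>L adj x)"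
  by (simp add: J_hat hat_comp M_comp M_adj x y adj_comp M_bounded adj_adj)

lemma AdJ_commutant:
  assumes x: "x \<in> M"
  shows "AdJ M hat x \<in> commutant M"
proof -
  have "AdJ M hat x o\<^sub>L y = y o\<^sub>L AdJ M hat x" if y: "y \<in> M" for y
    by (rule oper_eqI)
       (simp only: blinfun_apply_blinfun_compose AdJ_hat[OF x] hat_comp y M_comp M_adj x blinfun_compose_assoc)
  then show ?thesis
    by (simp add: commutant_def AdJ_bounded M_bounded x)
qed

text \<open>Both for \<open>M'\<close> and for the commutant of the right multiplications, \<open>J\<close> implements the adjoint on the
  orbit of \<open>\<Omega>\<close>, just as it does for \<open>M\<close> by definition.\<close>

lemma J_commutant_\<Omega>:
  assumes S: "S \<in> commutant M"
  shows "J (S \<Omega>) = adj S \<Omega>"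
proof (rule cinner_ext, rule dense_eqI[where f = "\<lambda>z. cinner (J (S \<Omega>)) z" and g = "\<lambda>z. cinner (adj S \<Omega>) z"])
  fix x assume x: "x \<in> M"
  have Sb: "S \<in> bounded_ops" using S by (simp add: commutant_def)
  have "cinner (J (S \<Omega>)) (hat x) = cinner (J (hat x)) (S \<Omega>)" by (rule cinner_J_left)
  also have "\<dots> = cinner (adj x \<Omega>) (S \<Omega>)" by (simp only: J_hat x hat_eq[OF M_adj[OF x]])
  also have "\<dots> = cinner \<Omega> (x (S \<Omega>))" by (rule cinner_adj_left[OF M_bounded[OF x]])
  also have "\<dots> = cinner \<Omega> (S (hat x))" by (simp only: hat_eq[OF x] commutant_apply[OF S x])
  also have "\<dots> = cinner (adj S \<Omega>) (hat x)" by (rule cinner_adj_left[OF Sb, symmetric])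
  finally show "cinner (J (S \<Omega>)) (hat x) = cinner (adj S \<Omega>) (hat x)" .
qed (intro continuous_intros)+

lemma J_right_commutant_\<Omega>:
  assumes T: "T \<in> commutant (AdJ M hat ` M)"
  shows "J (T \<Omega>) = adj T \<Omega>"
proof (rule cinner_ext, rule dense_eqI[where f = "\<lambda>z. cinner (J (T \<Omega>)) z" and g = "\<lambda>z. cinner (adj T \<Omega>) z"])
  fix x assume x: "x \<in> M"
  have Tb: "T \<in> bounded_ops" using T by (simp add: commutant_def)
  let ?y = "AdJ M hat (adj x)"
  have y: "?y \<Omega> = hat x"
    using AdJ_hat[OF M_adj[OF x] M_id] by (simp add: adj_adj M_bounded x del: AdJ_apply)
  have "cinner (J (T \<Omega>)) (hat x) = cinner (J (hat x)) (T \<Omega>)" by (rule cinner_J_left)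
  also have "\<dots> = cinner (AdJ M hat x \<Omega>) (T \<Omega>)"
    by (simp add: J_hat x hat_eq[OF M_adj[OF x]] hat_eq[OF x])
  also have "\<dots> = cinner \<Omega> (?y (T \<Omega>))"
    using cinner_AdJ_adj[OF M_bounded[OF M_adj[OF x]], of \<Omega> "T \<Omega>"]
    by (simp only: adj_adj[OF M_bounded[OF x]])
  also have "\<dots> = cinner \<Omega> (T (?y \<Omega>))"
    using commutant_apply[OF T, of ?y \<Omega>] M_adj[OF x] by simp
  also have "\<dots> = cinner (adj T \<Omega>) (hat x)"
    unfolding y by (rule cinner_adj_left[OF Tb, symmetric])
  finally show "cinner (J (T \<Omega>)) (hat x) = cinner (adj T \<Omega>) (hat x)" .
qed (intro continuous_intros)+

text \<open>The inclusion \<open>(J M J)' \<subseteq> M\<close> of the commutation theorem. By the bicommutant property it suffices that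
  \<open>T\<close> commutes with every \<open>S\<close> in \<open>M'\<close>. With \<open>R = y\<^sup>* T x\<close>, which again commutes with \<open>J M J\<close>, one has
  \<open>\<langle>S T x \<Omega>, y \<Omega>\<rangle> = \<langle>R \<Omega>, S\<^sup>* \<Omega>\<rangle> = \<langle>R \<Omega>, J S \<Omega>\<rangle> = \<langle>S \<Omega>, J R \<Omega>\<rangle> = \<langle>S \<Omega>, R\<^sup>* \<Omega>\<rangle> = \<langle>T S x \<Omega>, y \<Omega>\<rangle>\<close>.\<close>

theorem right_commutant_subset:
  assumes T: "T \<in> commutant (AdJ M hat ` M)"
  shows "T \<in> M"
proof -
  have Tb: "T \<in> bounded_ops" using T by (simp add: commutant_def)
  have M_in: "x \<in> commutant (AdJ M hat ` M)" if "x \<in> M" for x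
    using AdJ_commutant that unfolding commutant_def by (auto simp: M_bounded)
  have "T o\<^sub>L S = S o\<^sub>L T" if S: "S \<in> commutant M" for S
  proof (rule oper_eqI)
    have Sb: "S \<in> bounded_ops" using S by (simp add: commutant_def)
    fix x assume x: "x \<in> M"
    show "(T o\<^sub>L S) (hat x) = (S o\<^sub>L T) (hat x)"
    proof (rule cinner_ext, rule dense_eqI[where f = "\<lambda>z. cinner ((T o\<^sub>L S) (hat x)) z"
            and g = "\<lambda>z. cinner ((S o\<^sub>L T) (hat x)) z"])
      fix y assume y: "y \<in> M"
      define R where "R = adj y o\<^sub>L (T o\<^sub>L x)"
      have R: "R \<in> commutant (AdJ M hat ` M)"
        unfolding R_def by (intro commutant_comp M_in M_adj x y T)
      have adjR: "adj R = adj x o\<^sub>L (adj T o\<^sub>L y)"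
        unfolding R_def
        by (simp add: adj_comp bounded_ops_comp M_bounded M_adj x y Tb adj_adj blinfun_compose_assoc)
      have "cinner (S (T (hat x))) (hat y) = cinner (T (x \<Omega>)) (adj S (y \<Omega>))"
        by (simp only: cinner_adj_right[OF Sb] hat_eq x y)
      also have "adj S (y \<Omega>) = y (adj S \<Omega>)"
      proof (rule cinner_ext)
        fix z
        have "cinner (adj S (y \<Omega>)) z = cinner \<Omega> (adj y (S z))"
          by (simp add: cinner_adj_left Sb cinner_adj_right M_bounded y)
        also have "\<dots> = cinner \<Omega> (S (adj y z))"
          by (simp only: commutant_apply[OF S M_adj[OF y]])
        also have "\<dots> = cinner (y (adj S \<Omega>)) z"
          by (simp add: cinner_adj_left[OF Sb, symmetric] cinner_adj_right M_bounded y)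
        finally show "cinner (adj S (y \<Omega>)) z = cinner (y (adj S \<Omega>)) z" .
      qed
      also have "cinner (T (x \<Omega>)) (y (adj S \<Omega>)) = cinner (R \<Omega>) (adj S \<Omega>)"
        by (simp add: R_def cinner_adj_left M_bounded y)
      also have "\<dots> = cinner (R \<Omega>) (J (S \<Omega>))"
        by (simp only: J_commutant_\<Omega>[OF S])
      also have "\<dots> = cinner (S \<Omega>) (J (R \<Omega>))"
        using cinner_J_J[of "J (R \<Omega>)" "S \<Omega>"] by simp
      also have "\<dots> = cinner (S \<Omega>) (adj x (adj T (hat y)))"
        by (simp add: J_right_commutant_\<Omega>[OF R] adjR hat_eq[OF y])
      also have "\<dots> = cinner (T (x (S \<Omega>))) (hat y)"
        by (simp only: cinner_adj_right M_bounded x Tb)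
      also have "\<dots> = cinner (T (S (hat x))) (hat y)"
        by (simp only: hat_eq[OF x] commutant_apply[OF S x])
      finally show "cinner ((T o\<^sub>L S) (hat x)) (hat y) = cinner ((S o\<^sub>L T) (hat x)) (hat y)"
        by simp
    qed (intro continuous_intros)+
  qed
  then have "T \<in> commutant (commutant M)"
    using Tb by (simp add: commutant_def)
  then show ?thesis by (simp only: bicommutant)
qed

end

section \<open>Doubly harmonic operators are central\<close>

lemma harmonic_adj:
  assumes T: "T \<in> bounded_ops" and h: "harmonic c T"
  shows "harmonic c (adj T)"
proof -
  have adj: "inner (adj T x) y = inner (T y) x" for x y
    by (simp add: inner_eq_Re_cinner cinner_adj_left[OF T]) (metis cinner_commute cnj.sel(1))
  show ?thesis
    using h unfolding harmonic_def adj by (simp add: inner_commute)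
qed

context tracial_L2
begin

abbreviation Ad :: "'h oper \<Rightarrow> 'h oper" where "Ad \<equiv> AdJ M hat"

text \<open>The words in \<open>J z\<^sub>m J\<close> applied to \<open>\<Omega>\<close> span the image under \<open>J\<close> of the orbit of \<open>\<Omega>\<close> under the algebra
  generated by the \<open>z m\<close>. Since that algebra is weakly dense in \<open>M\<close>, an operator vanishing on these
  words vanishes on \<open>hat ` M\<close>. The words contain no adjoints of the \<open>z m\<close>, so density of the generated
  \<open>*\<close>-algebra would be too weak here.\<close>

lemma right_action_word_separates:
  assumes z: "\<And>n. z n \<in> M"
    and gen: "M \<subseteq> weak_operator_topology closure_of (unital_subalgebra hull range z)"
    and S: "S \<in> bounded_ops"
    and words: "\<And>ms. S (fold (\<lambda>m. blinfun_apply (Ad (z m))) ms \<Omega>) = 0"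
  shows "S = 0"
proof -
  let ?w = "fold (\<lambda>m. blinfun_apply (Ad (z m)))"
  \<comment> \<open>\<open>V\<close> is a subspace invariant under every \<open>J z\<^sub>m J\<close>, and \<open>B\<close> below is the algebra of all \<open>y\<close> for which
    \<open>J y J\<close> leaves it invariant.\<close>
  define V where "V = {v. \<forall>ms. S (?w ms v) = 0}"
  have fold_add: "?w ms (u + v) = ?w ms u + ?w ms v" for ms u v
    by (induction ms arbitrary: u v) (simp_all add: blinfun.add_right)
  have fold_scale: "?w ms (c *\<^sub>C v) = c *\<^sub>C ?w ms v" for ms c v
    by (induction ms arbitrary: v) (simp_all add: bounded_opsD AdJ_bounded M_bounded z del: AdJ_apply)
  have V_add: "u + v \<in> V" if "u \<in> V" "v \<in> V" for u v
    using that by (simp add: V_def fold_add blinfun.add_right)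
  have V_scale: "c *\<^sub>C v \<in> V" if "v \<in> V" for c v
  proof -
    have "c *\<^sub>C (0 :: 'h) = 0" using norm_scaleC[of c "0 :: 'h"] by simp
    then show ?thesis using that by (simp add: V_def fold_scale bounded_opsD[OF S])
  qed
  have V_step: "Ad (z m) v \<in> V" if "v \<in> V" for m v
    unfolding V_def
  proof safe
    fix ms
    have "S (?w (m # ms) v) = 0" using that by (simp only: V_def mem_Collect_eq)
    then show "S (?w ms (Ad (z m) v)) = 0" by simp
  qed
  define B where "B = {y \<in> bounded_ops. \<forall>v\<in>V. Ad y v \<in> V}"
  have "unital_subalgebra B"
    unfolding unital_subalgebra_def
  proof (intro conjI ballI allI)
    show "B \<subseteq> bounded_ops" "id_blinfun \<in> B"
      by (auto simp: B_def bounded_ops_id)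
  next
    fix x y assume xy: "x \<in> B" "y \<in> B"
    show "x + y \<in> B"
      using xy V_add by (auto simp: B_def bounded_ops_add blinfun.add_left blinfun.add_right)
    have "Ad x (Ad y v) \<in> V" if "v \<in> V" for v
      using xy that by (simp add: B_def del: AdJ_apply)
    then show "x o\<^sub>L y \<in> B"
      using xy by (auto simp: B_def bounded_ops_comp)
  next
    fix c x assume "x \<in> B"
    then show "scale_op c x \<in> B"
      using V_scale by (auto simp: B_def bounded_ops_scale scale_op_apply J_scale)
  qed
  moreover have "range z \<subseteq> B"
    using V_step z by (auto simp: B_def M_bounded simp del: AdJ_apply)
  ultimately have hull: "unital_subalgebra hull range z \<subseteq> B"
    by (intro hull_minimal)
  have "\<Omega> \<in> V" using words by (simp add: V_def)
  have kills: "S (J (y \<Omega>)) = 0" if "y \<in> unital_subalgebra hull range z" for y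
  proof -
    have "Ad y \<Omega> \<in> V" using hull that \<open>\<Omega> \<in> V\<close> by (auto simp: B_def simp del: AdJ_apply)
    then have "S (?w [] (Ad y \<Omega>)) = 0" unfolding V_def by blast
    then show ?thesis by simp
  qed
  have move: "cinner (S (J (y \<Omega>))) \<eta> = cnj (cinner (y \<Omega>) (J (adj S \<eta>)))" for y :: "'h oper" and \<eta>
  proof -
    have "cinner (S (J (y \<Omega>))) \<eta> = cinner (J (y \<Omega>)) (adj S \<eta>)"
      by (rule cinner_adj_right[OF S, symmetric])
    also have "\<dots> = cinner (J (adj S \<eta>)) (y \<Omega>)" by (rule cinner_J_left)
    finally show ?thesis by (simp only: cinner_commute[of "J (adj S \<eta>)"])
  qed
  have "S (J (x \<Omega>)) = 0" if x: "x \<in> M" for x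
  proof (rule cinner_ext)
    fix \<eta>
    have "cinner (x \<Omega>) (J (adj S \<eta>)) = cinner (x \<Omega>) 0"
    proof (rule wot_closure_cinner_eq)
      show "x \<in> weak_operator_topology closure_of (unital_subalgebra hull range z)"
        using gen x by blast
    next
      fix y assume "y \<in> unital_subalgebra hull range z"
      then show "cinner (y \<Omega>) (J (adj S \<eta>)) = cinner (y \<Omega>) 0"
        using kills[of y] move[of y \<eta>] by simp
    qed
    then show "cinner (S (J (x \<Omega>))) \<eta> = cinner 0 \<eta>"
      by (simp add: move)
  qed
  then have "S (hat x) = 0" if "x \<in> M" for x
    using that M_adj[OF that] by (metis J_J J_hat hat_eq)
  then show ?thesis by (intro oper_eqI) simp
qed

lemma commutant_of_generators:
  assumes gen: "M \<subseteq> weak_operator_topology closure_of (unital_subalgebra hull range z)"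
    and z: "\<And>n. z n \<in> M"
    and T: "T \<in> bounded_ops" and comm: "\<And>n. T o\<^sub>L z n = z n o\<^sub>L T"
  shows "T \<in> commutant M"
proof -
  define B where "B = {y \<in> bounded_ops. \<forall>\<xi>. T (y \<xi>) = y (T \<xi>)}"
  have "unital_subalgebra B"
    unfolding unital_subalgebra_def
    by (auto simp: B_def bounded_ops_id bounded_ops_add bounded_ops_comp bounded_ops_scale
        scale_op_apply bounded_opsD[OF T] blinfun.add_left blinfun.add_right)
  moreover have "range z \<subseteq> B"
    using z comm by (auto simp: B_def M_bounded simp flip: blinfun_apply_blinfun_compose)
  ultimately have hull: "unital_subalgebra hull range z \<subseteq> B"
    by (intro hull_minimal)
  show ?thesis
  proof (rule commutantI[OF T], rule cinner_ext)
    fix x \<xi> \<eta> assume x: "x \<in> M"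
    have "cinner (x \<xi>) (adj T \<eta>) = cinner (x (T \<xi>)) \<eta>"
    proof (rule wot_closure_cinner_eq)
      show "x \<in> weak_operator_topology closure_of (unital_subalgebra hull range z)"
        using gen x by blast
    next
      fix y assume "y \<in> unital_subalgebra hull range z"
      then have "T (y \<xi>) = y (T \<xi>)" using hull by (auto simp: B_def)
      then show "cinner (y \<xi>) (adj T \<eta>) = cinner (y (T \<xi>)) \<eta>"
        by (simp add: cinner_adj_right[OF T])
    qed
    then show "cinner (T (x \<xi>)) \<eta> = cinner (x (T \<xi>)) \<eta>"
      by (simp add: cinner_adj_right[OF T])
  qed
qed

lemma right_action_\<Omega>:
  assumes x: "x \<in> M"
  shows "Ad x \<Omega> = adj x \<Omega>"
  by (simp only: AdJ_hat[OF x M_id] id_blinfun_compose hat_eq[OF M_adj[OF x]])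

text \<open>The commutators \<open>[T, z\<^sub>n\<^sup>*]\<close> annihilate all words in \<open>J z\<^sub>m J\<close> applied to \<open>\<Omega>\<close>, hence vanish; the same
  for \<open>T\<^sup>*\<close> shows that \<open>T\<close> commutes with the \<open>z\<^sub>n\<close>, so \<open>T\<close> lies in \<open>M'\<close>. For \<open>T\<close> in \<open>M'\<close> the defect identity
  at \<open>\<Omega>\<close> becomes an equality without defect, since \<open>\<Sum>n. \<parallel>T z\<^sub>n\<^sup>* \<Omega>\<parallel>\<^sup>2 = (\<Sum>n. \<parallel>z\<^sub>n\<^sup>* T \<Omega>\<parallel>\<^sup>2) = \<parallel>T \<Omega>\<parallel>\<^sup>2\<close>. So \<open>T\<close>
  commutes with \<open>J z\<^sub>n J\<close> at \<open>\<Omega>\<close>, and everywhere because \<open>\<Omega>\<close> is cyclic for \<open>M\<close>. Thus \<open>J T J\<close> lies in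
  \<open>M'\<close> as well, and the commutation theorem puts \<open>T\<close> into \<open>M\<close>.\<close>

theorem doubly_harmonic_central:
  assumes z: "\<And>n. z n \<in> M"
    and gen: "M \<subseteq> weak_operator_topology closure_of (unital_subalgebra hull range z)"
    and a: "column_isometry (\<lambda>n. Ad (z n))" and c: "column_isometry (\<lambda>n. adj (z n))"
    and T: "T \<in> bounded_ops"
    and Ta: "harmonic (\<lambda>n. Ad (z n)) T" and Tc: "harmonic (\<lambda>n. adj (z n)) T"
  shows "T \<in> center M"
proof -
  have comm_adj: "R o\<^sub>L adj (z n) = adj (z n) o\<^sub>L R"
    if R: "R \<in> bounded_ops" "harmonic (\<lambda>n. Ad (z n)) R" "harmonic (\<lambda>n. adj (z n)) R" for R n
  proof -
    have "(R o\<^sub>L adj (z n)) - (adj (z n) o\<^sub>L R) = 0"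
    proof (rule right_action_word_separates[OF z gen])
      show "(R o\<^sub>L adj (z n)) - (adj (z n) o\<^sub>L R) \<in> bounded_ops"
        by (intro bounded_ops_diff bounded_ops_comp R M_bounded M_adj z)
      fix ms
      show "((R o\<^sub>L adj (z n)) - (adj (z n) o\<^sub>L R)) (fold (\<lambda>m. blinfun_apply (Ad (z m))) ms \<Omega>) = 0"
      proof (rule doubly_harmonic_commutator_kills_words[OF a c _ _ _ _ R(2,3)])
        show "inner (adj (z n) \<xi>) \<eta> = inner \<xi> (z n \<eta>)" for n \<xi> \<eta>
          by (simp add: inner_eq_Re_cinner cinner_adj_left M_bounded z)
        show "adj (z n) (Ad (z m) \<xi>) = Ad (z m) (adj (z n) \<xi>)" for m n \<xi>
          by (rule commutant_apply[OF AdJ_commutant[OF z] M_adj[OF z], symmetric])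
        show "z n (Ad (z m) \<xi>) = Ad (z m) (z n \<xi>)" for m n \<xi>
          by (rule commutant_apply[OF AdJ_commutant[OF z] z, symmetric])
        show "Ad (z n) \<Omega> = adj (z n) \<Omega>" for n
          by (rule right_action_\<Omega>[OF z])
      qed
    qed
    then show ?thesis by simp
  qed
  have comm: "T o\<^sub>L z n = z n o\<^sub>L T" for n
  proof -
    have "adj (adj T o\<^sub>L adj (z n)) = adj (adj (z n) o\<^sub>L adj T)"
      by (simp only: comm_adj[OF adj_in[OF T] harmonic_adj[OF T Ta] harmonic_adj[OF T Tc]])
    then show ?thesis
      by (simp add: adj_comp adj_in T M_bounded M_adj z adj_adj)
  qed
  have TM: "T \<in> commutant M"
    by (rule commutant_of_generators[OF gen z T comm])
  have \<Omega>_comm: "T (Ad (z m) \<Omega>) = Ad (z m) (T \<Omega>)" for m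
  proof -
    let ?defect = "\<lambda>n. ennreal ((norm (T (Ad (z n) \<Omega>) - Ad (z n) (T \<Omega>)))\<^sup>2)"
    have "push (\<lambda>n. Ad (z n)) (\<lambda>\<xi>. ennreal ((norm (T \<xi>))\<^sup>2)) \<Omega>
        = (\<Sum>n. ennreal ((norm (adj (z n) (T \<Omega>)))\<^sup>2))"
      unfolding push_def
      by (simp only: right_action_\<Omega>[OF z] commutant_apply[OF TM M_adj[OF z]])
    also have "\<dots> = ennreal ((norm (T \<Omega>))\<^sup>2)"
      using c by (intro suminf_ennreal_eq) (auto simp: column_isometry_def)
    finally have "ennreal ((norm (T \<Omega>))\<^sup>2) + (\<Sum>n. ?defect n) = ennreal ((norm (T \<Omega>))\<^sup>2)"
      using harmonic_defect[OF a Ta, of \<Omega>] by (simp only:)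
    then have "(\<Sum>n. ?defect n) = 0"
      using ennreal_add_left_cancel[of "ennreal ((norm (T \<Omega>))\<^sup>2)" "\<Sum>n. ?defect n" 0]
      by (simp only: add_0_right ennreal_neq_top simp_thms infinity_ennreal_def)
    then have "?defect m \<le> 0"
      using sum_le_suminf[of ?defect "{m}"] by (simp del: AdJ_apply)
    then show ?thesis by (simp del: AdJ_apply)
  qed
  have Ta_comm: "T (Ad (z m) \<xi>) = Ad (z m) (T \<xi>)" for m \<xi>
  proof -
    have "T o\<^sub>L Ad (z m) = Ad (z m) o\<^sub>L T"
    proof (rule oper_eqI)
      fix x assume x: "x \<in> M"
      note Tx = commutant_apply[OF TM x] and ax = commutant_apply[OF AdJ_commutant[OF z] x]
      have "T (Ad (z m) (x \<Omega>)) = x (T (Ad (z m) \<Omega>))" by (simp only: ax Tx)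
      also have "\<dots> = Ad (z m) (T (x \<Omega>))" by (simp only: \<Omega>_comm ax Tx)
      finally show "(T o\<^sub>L Ad (z m)) (hat x) = (Ad (z m) o\<^sub>L T) (hat x)"
        by (simp only: hat_eq[OF x] blinfun_apply_blinfun_compose)
    qed
    from arg_cong[OF this, of "\<lambda>R. blinfun_apply R \<xi>"] show ?thesis by simp
  qed
  have "Ad T \<in> commutant M"
  proof (rule commutant_of_generators[OF gen z AdJ_bounded[OF T]])
    show "Ad T o\<^sub>L z n = z n o\<^sub>L Ad T" for n
    proof (rule blinfun_eqI)
      show "(Ad T o\<^sub>L z n) \<xi> = (z n o\<^sub>L Ad T) \<xi>" for \<xi>
        using Ta_comm[of n "J \<xi>"] by simp
    qed
  qed
  then have "T \<in> commutant (Ad ` M)"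
  proof (intro commutantI[OF T])
    fix y \<xi> assume "Ad T \<in> commutant M" "y \<in> Ad ` M"
    then obtain x where x: "x \<in> M" "y = Ad x" by blast
    show "T (y \<xi>) = y (T \<xi>)"
      using arg_cong[OF commutant_apply[OF \<open>Ad T \<in> commutant M\<close> x(1), of "J \<xi>"], of "blinfun_apply J"]
      by (simp add: x(2))
  qed
  then have "T \<in> M" by (rule right_commutant_subset)
  with TM show ?thesis by (simp add: center_def)
qed

section \<open>Harmonic elements of the two maps of a hyperstate\<close>

lemma inner_AdJ_adj: "x \<in> M \<Longrightarrow> inner (Ad (adj x) \<xi>) \<eta> = inner \<xi> (Ad x \<eta>)"
  by (simp only: inner_eq_Re_cinner cinner_AdJ_adj M_bounded)

context
  fixes \<phi> :: "'h oper \<Rightarrow> complex" and z :: "nat \<Rightarrow> 'h oper"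
  assumes std: "standard_form M \<tau> hat \<phi> z" and reg: "regular M hat \<phi>"
begin

lemma z_in: "z n \<in> M"
  using std unfolding standard_form_def by blast

lemma z_sums: "(\<lambda>n. adj (z n) (z n \<xi>)) sums \<xi>"
proof -
  have "(\<lambda>n. (adj (z n) o\<^sub>L z n) \<xi>) sums \<xi>"
    using std unfolding standard_form_def by blast
  then show ?thesis by (simp only: blinfun_apply_blinfun_compose)
qed

lemma \<phi>_sums:
  "T \<in> bounded_ops \<Longrightarrow> (\<lambda>n. cinner (T (hat (adj (z n)))) (hat (adj (z n)))) sums \<phi> T"
  using std unfolding standard_form_def by blast

lemma hyper_map_sums:
  assumes "T \<in> bounded_ops"
  shows "(\<lambda>n. Ad (adj (z n)) (T (Ad (z n) \<xi>))) sums hyper_map M hat \<phi> T \<xi>"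
proof -
  have "(\<lambda>n. (Ad (adj (z n)) o\<^sub>L T o\<^sub>L Ad (z n)) \<xi>) sums hyper_map M hat \<phi> T \<xi>"
    using std assms unfolding standard_form_def by blast
  then show ?thesis by (simp only: blinfun_apply_blinfun_compose)
qed

lemma column_right: "column_isometry (\<lambda>n. Ad (z n))"
  unfolding column_isometry_def
proof
  fix \<xi>
  have "(\<lambda>n. cinner (adj (z n) (z n (J \<xi>))) (J \<xi>)) sums cinner (J \<xi>) (J \<xi>)"
    by (rule sums_cinner_left[OF z_sums])
  then have "(\<lambda>n. complex_of_real ((norm (z n (J \<xi>)))\<^sup>2)) sums complex_of_real ((norm (J \<xi>))\<^sup>2)"
    by (simp only: cinner_adj_left[OF M_bounded[OF z_in]] cinner_self)
  then show "(\<lambda>n. (norm (Ad (z n) \<xi>))\<^sup>2) sums (norm \<xi>)\<^sup>2"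
    unfolding sums_of_real_iff by simp
qed

text \<open>This is where regularity enters. Trace preservation at \<open>J x\<^sup>* x J\<close> reads
  \<open>(\<Sum>n. \<parallel>x z\<^sub>n \<Omega>\<parallel>\<^sup>2) = \<parallel>x \<Omega>\<parallel>\<^sup>2\<close>, and traciality converts it to \<open>(\<Sum>n. \<parallel>z\<^sub>n\<^sup>* x\<^sup>* \<Omega>\<parallel>\<^sup>2) = \<parallel>x\<^sup>* \<Omega>\<parallel>\<^sup>2\<close>, that is,
  \<open>(\<Sum>n. z\<^sub>n z\<^sub>n\<^sup>*) = 1\<close>.\<close>

lemma column_left: "column_isometry (\<lambda>n. adj (z n))"
proof (rule column_isometry_dense[where d = z, OF M_bounded[OF z_in] M_bounded[OF M_adj[OF z_in]] _ hat_dense])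
  show "cinner (z n x) y = cinner x (adj (z n) y)" for n x y
    by (simp add: cinner_adj_right M_bounded z_in)
next
  fix \<xi> assume "\<xi> \<in> hat ` M"
  then obtain x0 where x0: "x0 \<in> M" "\<xi> = hat x0" by blast
  define x where "x = adj x0"
  have x: "x \<in> M" and adj_x: "adj x = x0"
    by (simp_all add: x_def x0 M_adj adj_adj M_bounded)
  define y where "y = adj x o\<^sub>L x"
  have y: "y \<in> M" by (simp add: y_def M_comp M_adj x)
  have yy: "cinner v (y v) = complex_of_real ((norm (x v))\<^sup>2)" for v
    by (simp only: y_def blinfun_apply_blinfun_compose cinner_adj_right[OF M_bounded[OF x]] cinner_self)
  have "(\<lambda>n. cinner (Ad (adj (z n)) (Ad y (Ad (z n) \<Omega>))) \<Omega>) sums cinner (hyper_map M hat \<phi> (Ad y) \<Omega>) \<Omega>"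
    by (rule sums_cinner_left[OF hyper_map_sums[OF AdJ_bounded[OF M_bounded[OF y]]]])
  also have "cinner (hyper_map M hat \<phi> (Ad y) \<Omega>) \<Omega> = cinner (J (y \<Omega>)) (J \<Omega>)"
    using reg AdJ_commutant[OF y] by (simp add: regular_def)
  also have "\<dots> = complex_of_real ((norm (hat x0))\<^sup>2)"
    using norm_hat_adj[OF x] by (simp only: cinner_J_J yy adj_x hat_eq[OF x, symmetric])
  also have "(\<lambda>n. cinner (Ad (adj (z n)) (Ad y (Ad (z n) \<Omega>))) \<Omega>)
      = (\<lambda>n. complex_of_real ((norm (adj (z n) (hat x0)))\<^sup>2))"
  proof
    fix n
    have "cinner (Ad (adj (z n)) (Ad y (Ad (z n) \<Omega>))) \<Omega> = cinner (Ad y (Ad (z n) \<Omega>)) (Ad (z n) \<Omega>)"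
      by (rule cinner_AdJ_adj[OF M_bounded[OF z_in]])
    also have "\<dots> = cinner (J (y (z n \<Omega>))) (J (z n \<Omega>))" by simp
    also have "\<dots> = complex_of_real ((norm (x (hat (z n))))\<^sup>2)"
      by (simp only: cinner_J_J yy hat_eq[OF z_in])
    also have "norm (x (hat (z n))) = norm (hat (adj (x o\<^sub>L z n)))"
      by (simp only: hat_comp x z_in norm_hat_adj M_comp)
    also have "hat (adj (x o\<^sub>L z n)) = adj (z n) (hat x0)"
      by (simp only: adj_comp M_bounded x z_in adj_x hat_comp M_adj x0)
    finally show "cinner (Ad (adj (z n)) (Ad y (Ad (z n) \<Omega>))) \<Omega>
        = complex_of_real ((norm (adj (z n) (hat x0)))\<^sup>2)" .
  qed
  finally show "(\<lambda>n. (norm (adj (z n) \<xi>))\<^sup>2) sums (norm \<xi>)\<^sup>2"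
    unfolding sums_of_real_iff x0(2) .
qed

lemma column_right_adj: "column_isometry (\<lambda>n. Ad (adj (z n)))"
  unfolding column_isometry_def
proof
  fix \<xi>
  have "(\<lambda>n. (norm (adj (z n) (J \<xi>)))\<^sup>2) sums (norm (J \<xi>))\<^sup>2"
    using column_left unfolding column_isometry_def by blast
  then show "(\<lambda>n. (norm (Ad (adj (z n)) \<xi>))\<^sup>2) sums (norm \<xi>)\<^sup>2" by simp
qed

text \<open>The hyperstate \<open>\<phi>\<^sup>*\<close> arises from \<open>\<phi>\<close> by replacing every \<open>z\<^sub>n\<close> with its adjoint.\<close>

lemma star_hyperstate_sums:
  assumes X: "X \<in> bounded_ops"
  shows "(\<lambda>n. cinner (X (hat (z n))) (hat (z n))) sums star_hyperstate M hat \<phi> X"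
proof -
  have "cinner (Ad (adj X) (hat (adj (z n)))) (hat (adj (z n))) = cinner (X (hat (z n))) (hat (z n))" for n
  proof -
    have "cinner (Ad (adj X) (hat (adj (z n)))) (hat (adj (z n)))
        = cinner (J (adj X (hat (z n)))) (J (hat (z n)))"
      using J_J[of "hat (z n)"] by (simp add: J_hat[OF z_in, symmetric] del: J_J) 
    then show ?thesis by (simp add: cinner_J_J cinner_adj_right[OF X])
  qed
  then show ?thesis
    using \<phi>_sums[OF AdJ_bounded[OF adj_in[OF X]]] by (simp only: star_hyperstate_def)
qed

abbreviation "star_map \<equiv> restrict (sandwich (\<lambda>n. Ad (z n)) (\<lambda>n. Ad (adj (z n)))) bounded_ops"

lemma Ad_z_bounded: "Ad (z n) \<in> bounded_ops" "Ad (adj (z n)) \<in> bounded_ops"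
  by (simp_all only: AdJ_bounded M_bounded M_adj z_in)

lemma cinner_Ad_z: "cinner (Ad (z n) \<xi>) \<eta> = cinner \<xi> (Ad (adj (z n)) \<eta>)"
  using cinner_AdJ_adj[OF M_bounded[OF M_adj[OF z_in]]] by (simp only: adj_adj[OF M_bounded[OF z_in]])

lemma star_map_sums:
  assumes "T \<in> bounded_ops"
  shows "(\<lambda>n. Ad (z n) (T (Ad (adj (z n)) \<xi>))) sums star_map T \<xi>"
  using sandwich_sums[OF Ad_z_bounded cinner_Ad_z column_right_adj assms] assms
  by (simp only: restrict_apply if_True simp_thms)

lemma star_map_ucp: "ucp star_map"
  by (rule sandwich_ucp[OF Ad_z_bounded cinner_Ad_z column_right_adj]) simp

text \<open>\<^const>\<open>hyper_map\<close> is a definite description, so for \<open>\<phi>\<^sup>*\<close> the map has to be constructed before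
  anything can be said about it. The reproducing property determines it on the dense subspace
  \<open>hat ` M\<close>.\<close>

lemma hyper_map_star: "hyper_map M hat (star_hyperstate M hat \<phi>) = star_map"
  unfolding hyper_map_def
proof (rule the_equality)
  have bimod: "bimodular M star_map"
    unfolding bimodular_def
  proof (intro ballI)
    fix x y T :: "'h oper" assume x: "x \<in> M" and y: "y \<in> M" and T: "T \<in> bounded_ops"
    have xTy: "x o\<^sub>L T o\<^sub>L y \<in> bounded_ops" by (intro bounded_ops_comp M_bounded x y T)
    show "star_map (x o\<^sub>L T o\<^sub>L y) = x o\<^sub>L star_map T o\<^sub>L y"
    proof (rule blinfun_eqI, rule sums_unique2)
      fix \<xi>
      show "(\<lambda>n. Ad (z n) ((x o\<^sub>L T o\<^sub>L y) (Ad (adj (z n)) \<xi>))) sums star_map (x o\<^sub>L T o\<^sub>L y) \<xi>"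
        by (rule star_map_sums[OF xTy])
      have "(\<lambda>n. x (Ad (z n) (T (Ad (adj (z n)) (y \<xi>))))) sums x (star_map T (y \<xi>))"
        by (rule bounded_linear.sums[OF blinfun.bounded_linear_right star_map_sums[OF T]])
      then show "(\<lambda>n. Ad (z n) ((x o\<^sub>L T o\<^sub>L y) (Ad (adj (z n)) \<xi>))) sums (x o\<^sub>L star_map T o\<^sub>L y) \<xi>"
        by (simp only: blinfun_apply_blinfun_compose commutant_apply[OF AdJ_commutant[OF z_in] x]
            commutant_apply[OF AdJ_commutant[OF M_adj[OF z_in]] y])
    qed
  qed
  have repr: "cinner (star_map T (hat y)) (hat w) = star_hyperstate M hat \<phi> (adj w o\<^sub>L T o\<^sub>L y)"
    if T: "T \<in> bounded_ops" and y: "y \<in> M" and w: "w \<in> M" for T y w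
  proof (rule sums_unique2)
    have move: "Ad (adj (z n)) (hat x) = x (hat (z n))" if "x \<in> M" for x n
      by (simp only: AdJ_hat[OF M_adj[OF z_in] that] adj_adj[OF M_bounded[OF z_in]] hat_comp[OF that z_in])
    show "(\<lambda>n. cinner (Ad (z n) (T (Ad (adj (z n)) (hat y)))) (hat w)) sums cinner (star_map T (hat y)) (hat w)"
      by (rule sums_cinner_left[OF star_map_sums[OF T]])
    have "(\<lambda>n. cinner ((adj w o\<^sub>L T o\<^sub>L y) (hat (z n))) (hat (z n)))
        sums star_hyperstate M hat \<phi> (adj w o\<^sub>L T o\<^sub>L y)"
      by (intro star_hyperstate_sums bounded_ops_comp M_bounded M_adj w T y)
    then show "(\<lambda>n. cinner (Ad (z n) (T (Ad (adj (z n)) (hat y)))) (hat w))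
        sums star_hyperstate M hat \<phi> (adj w o\<^sub>L T o\<^sub>L y)"
      by (simp only: cinner_Ad_z move[OF y] move[OF w] blinfun_apply_blinfun_compose
          cinner_adj_left[OF M_bounded[OF w]])
  qed
  show *: "star_map \<in> extensional bounded_ops \<and> ucp star_map \<and> bimodular M star_map \<and>
      (\<forall>T\<in>bounded_ops. \<forall>y\<in>M. \<forall>w\<in>M. cinner (star_map T (hat y)) (hat w)
          = star_hyperstate M hat \<phi> (adj w o\<^sub>L T o\<^sub>L y))"
    using star_map_ucp bimod repr by blast
  fix P :: "'h oper \<Rightarrow> 'h oper"
  assume P: "P \<in> extensional bounded_ops \<and> ucp P \<and> bimodular M P \<and>
      (\<forall>T\<in>bounded_ops. \<forall>y\<in>M. \<forall>w\<in>M. cinner (P T (hat y)) (hat w)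
          = star_hyperstate M hat \<phi> (adj w o\<^sub>L T o\<^sub>L y))"
  show "P = star_map"
  proof (rule extensionalityI[of _ bounded_ops])
    show "P \<in> extensional bounded_ops" "star_map \<in> extensional bounded_ops"
      using P by auto
    fix T :: "'h oper" assume T: "T \<in> bounded_ops"
    show "P T = star_map T"
    proof (rule oper_eqI, rule cinner_ext)
      fix x v assume x: "x \<in> M"
      show "cinner (P T (hat x)) v = cinner (star_map T (hat x)) v"
      proof (rule dense_eqI[where f = "\<lambda>v. cinner (P T (hat x)) v" and g = "\<lambda>v. cinner (star_map T (hat x)) v"])
        fix w assume w: "w \<in> M"
        have "cinner (P T (hat x)) (hat w) = star_hyperstate M hat \<phi> (adj w o\<^sub>L T o\<^sub>L x)"
          using P T x w by blast
        then show "cinner (P T (hat x)) (hat w) = cinner (star_map T (hat x)) (hat w)"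
          by (simp only: repr[OF T x w])
      qed (intro continuous_on_cinner continuous_on_const continuous_on_id)+
    qed
  qed
qed

text \<open>Conjugating with \<open>J\<close> turns the right multiplications in the map of \<open>\<phi>\<^sup>*\<close> into left ones, so that
  the opposite map is \<open>T \<mapsto> (\<Sum>n. z\<^sub>n T z\<^sub>n\<^sup>*)\<close>.\<close>

lemma opp_hyper_map_sums:
  assumes T: "T \<in> bounded_ops"
  shows "(\<lambda>n. z n (T (adj (z n) \<xi>))) sums opp_hyper_map M hat \<phi> T \<xi>"
proof -
  have "(\<lambda>n. J (Ad (z n) (Ad T (Ad (adj (z n)) (J \<xi>))))) sums J (star_map (Ad T) (J \<xi>))"
    by (rule bounded_linear.sums[OF blinfun.bounded_linear_right star_map_sums[OF AdJ_bounded[OF T]]])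
  then show ?thesis
    by (simp add: opp_hyper_map_def hyper_map_star del: restrict_apply)
qed

lemma opp_hyper_map_id: "opp_hyper_map M hat \<phi> id_blinfun = id_blinfun"
proof (rule blinfun_eqI)
  fix \<xi>
  have "Ad id_blinfun = id_blinfun" by (rule blinfun_eqI) simp
  moreover have "star_map id_blinfun = id_blinfun"
    using star_map_ucp by (simp only: ucp_def)
  ultimately show "opp_hyper_map M hat \<phi> id_blinfun \<xi> = id_blinfun \<xi>"
    by (simp add: opp_hyper_map_def hyper_map_star del: restrict_apply)
qed

lemma Har_hyper_map_harmonic:
  assumes "T \<in> Har bounded_ops (hyper_map M hat \<phi>)"
  shows "harmonic (\<lambda>n. Ad (z n)) T"
  unfolding harmonic_def
proof (intro allI)
  fix \<xi> \<eta>
  have T: "T \<in> bounded_ops" "hyper_map M hat \<phi> T = T"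
    using assms by (auto simp: Har_def)
  have "(\<lambda>n. inner (Ad (adj (z n)) (T (Ad (z n) \<xi>))) \<eta>) sums inner (T \<xi>) \<eta>"
    using bounded_linear.sums[OF bounded_linear_inner_left hyper_map_sums[OF T(1)]] by (simp only: T(2))
  then show "(\<lambda>n. inner (T (Ad (z n) \<xi>)) (Ad (z n) \<eta>)) sums inner (T \<xi>) \<eta>"
    by (simp only: inner_AdJ_adj[OF z_in])
qed

lemma Har_opp_hyper_map_harmonic:
  assumes "T \<in> Har bounded_ops (opp_hyper_map M hat \<phi>)"
  shows "harmonic (\<lambda>n. adj (z n)) T"
  unfolding harmonic_def
proof (intro allI)
  fix \<xi> \<eta>
  have T: "T \<in> bounded_ops" "opp_hyper_map M hat \<phi> T = T"
    using assms by (auto simp: Har_def)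
  have "(\<lambda>n. inner (z n (T (adj (z n) \<xi>))) \<eta>) sums inner (T \<xi>) \<eta>"
    using bounded_linear.sums[OF bounded_linear_inner_left opp_hyper_map_sums[OF T(1)]] by (simp only: T(2))
  then show "(\<lambda>n. inner (T (adj (z n) \<xi>)) (adj (z n) \<eta>)) sums inner (T \<xi>) \<eta>"
    by (simp only: inner_eq_Re_cinner cinner_adj_right[OF M_bounded[OF z_in]])
qed

lemma center_Har_hyper_map:
  assumes "T \<in> center M"
  shows "T \<in> Har bounded_ops (hyper_map M hat \<phi>)"
proof -
  have TM: "T \<in> M" and T: "T \<in> bounded_ops"
    using assms by (auto simp: center_def M_bounded)
  have "hyper_map M hat \<phi> T = T"
  proof (rule blinfun_eqI, rule sums_unique2)
    fix \<xi>
    show "(\<lambda>n. Ad (adj (z n)) (T (Ad (z n) \<xi>))) sums hyper_map M hat \<phi> T \<xi>"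
      by (rule hyper_map_sums[OF T])
    have "(\<lambda>n. T (J (adj (z n) (z n (J \<xi>))))) sums T (J (J \<xi>))"
      by (intro bounded_linear.sums[OF blinfun.bounded_linear_right] z_sums)
    moreover have "Ad (adj (z n)) (T (Ad (z n) \<xi>)) = T (J (adj (z n) (z n (J \<xi>))))" for n
      by (simp only: commutant_apply[OF AdJ_commutant[OF M_adj[OF z_in]] TM]) simp
    ultimately show "(\<lambda>n. Ad (adj (z n)) (T (Ad (z n) \<xi>))) sums T \<xi>"
      by (simp only: J_J)
  qed
  with T show ?thesis by (simp add: Har_def)
qed

lemma center_Har_opp_hyper_map:
  assumes "T \<in> center M"
  shows "T \<in> Har bounded_ops (opp_hyper_map M hat \<phi>)"
proof -
  have TM: "T \<in> commutant M" and T: "T \<in> bounded_ops"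
    using assms by (auto simp: center_def commutant_def)
  have "opp_hyper_map M hat \<phi> T = T"
  proof (rule blinfun_eqI, rule sums_unique2)
    fix \<xi>
    show "(\<lambda>n. z n (T (adj (z n) \<xi>))) sums opp_hyper_map M hat \<phi> T \<xi>"
      by (rule opp_hyper_map_sums[OF T])
    have "(\<lambda>n. T (z n (adj (z n) \<xi>))) sums T \<xi>"
      using bounded_linear.sums[OF blinfun.bounded_linear_right[of T] opp_hyper_map_sums[OF bounded_ops_id, of \<xi>]]
      by (simp only: opp_hyper_map_id blinfun_apply_id_blinfun)
    then show "(\<lambda>n. z n (T (adj (z n) \<xi>))) sums T \<xi>"
      by (simp only: commutant_apply[OF TM z_in])
  qed
  with T show ?thesis by (simp add: Har_def)
qed

end

end

theorem theorem3p1: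
  fixes M :: "'h::chilbert_space oper set"
    and \<tau> :: "'h oper \<Rightarrow> complex"
    and hat :: "'h oper \<Rightarrow> 'h"
    and \<phi> :: "'h oper \<Rightarrow> complex"
  assumes "tracial_von_neumann_algebra M \<tau>"
    and "L2_representation M \<tau> hat"
    and "hyperstate M \<tau> \<phi>"
    and "normal_on bounded_ops \<phi>"
    and "regular M hat \<phi>"
    and "strongly_generating M \<tau> hat \<phi>"
  shows "Har bounded_ops (hyper_map M hat \<phi>) \<inter> Har bounded_ops (opp_hyper_map M hat \<phi>)
           = center M"
proof -
  interpret tracial_L2 M \<tau> hat by (rule tracial_L2.intro) fact+
  obtain z where std: "standard_form M \<tau> hat \<phi> z"
    and gen: "M \<subseteq> weak_operator_topology closure_of (unital_subalgebra hull range z)"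
    using assms(6) by (auto simp: strongly_generating_def)
  note std_reg = std assms(5)
  show ?thesis
  proof (intro equalityI subsetI IntI)
    fix T assume "T \<in> Har bounded_ops (hyper_map M hat \<phi>) \<inter> Har bounded_ops (opp_hyper_map M hat \<phi>)"
    then have T: "T \<in> Har bounded_ops (hyper_map M hat \<phi>)" "T \<in> Har bounded_ops (opp_hyper_map M hat \<phi>)"
      by simp_all
    show "T \<in> center M"
    proof (rule doubly_harmonic_central[OF z_in[OF std_reg] gen])
      show "T \<in> bounded_ops" using T(1) by (simp add: Har_def)
    qed (rule column_right[OF std_reg] column_left[OF std_reg]
        Har_hyper_map_harmonic[OF std_reg T(1)] Har_opp_hyper_map_harmonic[OF std_reg T(2)])+
  qed (rule center_Har_hyper_map[OF std_reg] center_Har_opp_hyper_map[OF std_reg]; assumption)+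
qed

end
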